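(* Let $\ell_1=\ell_2=1$. Every shape of elastica appears as the $x$-projection to $\mathbb{R}^2$ of a geodesic curve in ${\mathcal C}$; that is, for every elastic curve $E\subset\mathbb{R}^2$ there is a geodesic in ${\mathcal C}$ whose $x$-projection is similar to $E$.
   Context: 2-linkage: a triple of points $x,m_1,m_2\in\mathbb{R}^2$ with $|xm_1|=|xm_2|=1$. Coordinates: $x=(x_1,x_2)$ and the directions $\alpha_1,\alpha_2\in\mathbb{R}/2\pi\mathbb{Z}$ of the oriented segments $m_1x$, $m_2x$, so $m_i=x-(\cos\alpha_i,\sin\alpha_i)$. The configuration space ${\mathcal C}$ is $\mathbb{R}^2\times T^2$ with the set $\alpha_1=\alpha_2$ (i.e. $m_1=m_2$) removed. A curve in ${\mathcal C}$ is horizontal if the velocity of $m_i$ is parallel to the segment $m_ix$ for $i=1,2$. The length of a horizontal curve is the Euclidean length of its projection $x(t)$. A geodesic is a horizontal curve, parameterized by arc length, that locally minimizes length among horizontal curves with the same endpoints. By sub-Riemannian theory, the projections to ${\mathcal C}$ of the trajectories on the level $H=\frac12$ of the Hamiltonian system on $T^*{\mathcal C}$ (coordinates $(x_1,x_2,\alpha_1,\alpha_2,p_1,p_2,\eta_1,\eta_2)$, standard symplectic form) with $H=\frac12\left[(p_1-\eta_1\sin\alpha_1-\eta_2\sin\alpha_2)^2+(p_2+\eta_1\cos\alpha_1+\eta_2\cos\alpha_2)^2\right]$ are geodesics. An elastic curve (elastica) is a planar curve whose curvature $\kappa$, as a function of arc length, satisfies $\ddot\kappa+\frac12\kappa^3+A\kappa=0$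 for some constant $A$; integrating, $\dot\kappa^2+\frac14\kappa^4+A\kappa^2+B=0$ for a constant $B$. The shape of an elastica means its similarity class (it is determined by the scale-invariant parameter $\mu=B/A^2$). *)

theory Defs
  imports "HOL-Analysis.Analysis"
begin

text \<open>
  The Euclidean plane is represented by the type \<^typ>\<open>complex\<close>, so that multiplication by
  \<open>\<i>\<close> is the rotation by a right angle.  A linkage is a triple \<open>(x, m\<^sub>1, m\<^sub>2)\<close>.
\<close>

type_synonym linkage = "complex \<times> complex \<times> complex"

definition link_x :: "linkage \<Rightarrow> complex" where
  "link_x q = fst q"

definition config_space :: "linkage set" where
  "config_space = {(x, m1, m2). dist x m1 = 1 \<and> dist x m2 = 1 \<and> m1 \<noteq> m2}"

text \<open>
  The description by the position \<open>x\<close> and the directions \<open>\<alpha>\<^sub>1, \<alpha>\<^sub>2\<close> modulo \<open>2\<pi>\<close> of the oriented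
  segments \<open>m\<^sub>i x\<close>.
\<close>

lemma config_space_angles:
  "config_space = {(x, x - cis \<alpha>1, x - cis \<alpha>2) | x \<alpha>1 \<alpha>2. cis \<alpha>1 \<noteq> cis \<alpha>2}"
proof -
  have *: "\<exists>\<alpha>. m = x - cis \<alpha>" if "dist x m = 1" for x m
  proof
    have "x - m \<noteq> 0" "norm (x - m) = 1"
      using that by (auto simp: dist_norm)
    then have "cis (Arg (x - m)) = x - m"
      by (simp add: cis_Arg sgn_div_norm)
    then show "m = x - cis (Arg (x - m))"
      by simp
  qed
  show ?thesis
  proof (intro equalityI subsetI)
    fix q assume "q \<in> config_space"
    then obtain x m1 m2 where q: "q = (x, m1, m2)" "dist x m1 = 1" "dist x m2 = 1" "m1 \<noteq> m2"
      by (auto simp: config_space_def)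
    with * obtain \<alpha>1 \<alpha>2 where "m1 = x - cis \<alpha>1" "m2 = x - cis \<alpha>2"
      by metis
    with q show "q \<in> {(x, x - cis \<alpha>1, x - cis \<alpha>2) | x \<alpha>1 \<alpha>2. cis \<alpha>1 \<noteq> cis \<alpha>2}"
      by auto
  qed (auto simp: config_space_def dist_norm)
qed

text \<open>
  Horizontal curves are taken to be locally Lipschitz and differentiable almost everywhere, which
  is the usual regularity class for admissible curves in sub-Riemannian geometry.
\<close>

definition horizontal_on :: "real set \<Rightarrow> (real \<Rightarrow> linkage) \<Rightarrow> bool" where
  "horizontal_on J c \<longleftrightarrow>
     c \<in> J \<rightarrow> config_space \<and>
     (\<forall>a b. {a..b} \<subseteq> J \<longrightarrow> (\<exists>L. L-lipschitz_on {a..b} c)) \<and>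
     (\<exists>N. negligible N \<and>
       (\<forall>t\<in>J - N. \<exists>x m1 m2 x' m1' m2'.
          c t = (x, m1, m2) \<and>
          (c has_vector_derivative (x', m1', m2')) (at t within J) \<and>
          (\<exists>r1::real. m1' = r1 *\<^sub>R (x - m1)) \<and>
          (\<exists>r2::real. m2' = r2 *\<^sub>R (x - m2))))"

definition linkage_length :: "real \<Rightarrow> real \<Rightarrow> (real \<Rightarrow> linkage) \<Rightarrow> real" where
  "linkage_length a b c =
     integral {a..b} (\<lambda>t. norm (vector_derivative (link_x \<circ> c) (at t within {a..b})))"

text \<open>
  In the local minimality condition the competitors \<open>d\<close> range over all horizontal curves in the
  configuration space with the same end configurations, not only over those close to \<open>c\<close>.
\<close>

definition geodesic_on :: "real set \<Rightarrow> (real \<Rightarrow> linkage) \<Rightarrow> bool" where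
  "geodesic_on J c \<longleftrightarrow>
     is_interval J \<and> interior J \<noteq> {} \<and>
     horizontal_on J c \<and>
     (\<forall>a b. a \<le> b \<and> {a..b} \<subseteq> J \<longrightarrow> linkage_length a b c = b - a) \<and>
     (\<forall>t\<in>J. \<exists>\<epsilon>>0. \<forall>a b. a \<le> b \<and> {a..b} \<subseteq> J \<inter> ball t \<epsilon> \<longrightarrow>
        (\<forall>a' b' d. a' \<le> b' \<and> horizontal_on {a'..b'} d \<and> d a' = c a \<and> d b' = c b \<longrightarrow>
           linkage_length a b c \<le> linkage_length a' b' d))"

definition unit_speed_with_curvature ::
    "real set \<Rightarrow> (real \<Rightarrow> complex) \<Rightarrow> (real \<Rightarrow> real) \<Rightarrow> bool" where
  "unit_speed_with_curvature I \<gamma> \<kappa> \<longleftrightarrow>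
     (\<exists>T. \<forall>s\<in>I.
        (\<gamma> has_vector_derivative T s) (at s within I) \<and>
        norm (T s) = 1 \<and>
        (T has_vector_derivative \<kappa> s *\<^sub>R (\<i> * T s)) (at s within I))"

definition elastica_on :: "real set \<Rightarrow> (real \<Rightarrow> complex) \<Rightarrow> bool" where
  "elastica_on I \<gamma> \<longleftrightarrow>
     is_interval I \<and> interior I \<noteq> {} \<and>
     (\<exists>\<kappa> \<kappa>' \<kappa>'' A. unit_speed_with_curvature I \<gamma> \<kappa> \<and>
        (\<forall>s\<in>I. (\<kappa> has_real_derivative \<kappa>' s) (at s within I) \<and>
               (\<kappa>' has_real_derivative \<kappa>'' s) (at s within I) \<and>
               \<kappa>'' s + 1/2 * \<kappa> s ^ 3 + A * \<kappa> s = 0))"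

definition similarity :: "(complex \<Rightarrow> complex) \<Rightarrow> bool" where
  "similarity S \<longleftrightarrow> (\<exists>r>0. \<forall>u v. dist (S u) (S v) = r * dist u v)"

text \<open>Similarity of parametrized plane curves, up to a change of parameter.\<close>

definition similar_curves ::
    "real set \<Rightarrow> (real \<Rightarrow> complex) \<Rightarrow> real set \<Rightarrow> (real \<Rightarrow> complex) \<Rightarrow> bool" where
  "similar_curves I \<gamma> J \<delta> \<longleftrightarrow>
     (\<exists>S \<phi> \<psi>. similarity S \<and> homeomorphism I J \<phi> \<psi> \<and> (\<forall>s\<in>I. \<delta> (\<phi> s) = S (\<gamma> s)))"

end

theory Submission
  imports Defs
begin

text \<open>
  A curve of linkages is horizontal when each direction \<open>u\<^sub>j = x - m\<^sub>j\<close> follows the velocity \<open>P\<close> of \<open>x\<close> by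
  the rolling rule \<open>u\<^sub>j' = \<langle>P, \<i> u\<^sub>j\<rangle> \<i> u\<^sub>j\<close>.  In complex notation the Hamiltonian system on the level
  \<open>|P| = 1\<close> says that \<open>P = p + \<i> (\<eta>\<^sub>1 u\<^sub>1 + \<eta>\<^sub>2 u\<^sub>2)\<close> with a constant \<open>p\<close> and \<open>\<eta>\<^sub>j' = \<eta>\<^sub>j \<langle>P, u\<^sub>j\<rangle>\<close>; the
  curvature of \<open>x\<close> is then \<open>\<eta>\<^sub>1 + \<eta>\<^sub>2\<close>.  The locale \<open>normal_extremal\<close> collects these equations.  Two things
  have to be shown: such curves are geodesics, and every elastica, suitably enlarged, is the
  \<open>x\<close>-projection of one of them.

  Minimality is shown by a calibration with an explicit subsolution of the Hamilton-Jacobi equation.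
  Around a time \<open>t\<^sub>0\<close> let \<open>S(t, q)\<close> be linear in the
  displacement of \<open>q\<close> from the extremal at time \<open>t\<close>, with the momentum as its slope, minus
  \<open>C (t - t\<^sub>0) / 2\<close> times the squared displacement.  Its time derivative contains \<open>- C / 2\<close> times the
  squared displacement, which for large \<open>C\<close> and \<open>|t - t\<^sub>0| \<le> 1 / C\<close> absorbs all error terms, so that
  \<open>\<partial>\<^sub>t S + |\<nabla> S| \<le> 0\<close> for all linkages \<open>q\<close>, where \<open>\<nabla>\<close> is the horizontal gradient
  (\<open>calib_subsolution\<close>).  Let a competitor from \<open>c a\<close> to \<open>c b\<close> be given and run the clock
  \<open>t = a + arc length\<close> along it.  Then \<open>S\<close> does not increase, so it is nonpositive at \<open>c b\<close> when
  the clock shows \<open>a + l\<close>, where \<open>l\<close> is the length of the competitor (\<open>calib_competitor\<close>).  But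
  \<open>S(t, c b)\<close> decreases strictly in \<open>t\<close> and vanishes at \<open>t = b\<close>, whence \<open>l \<ge> b - a\<close>
  (\<open>competitor_is_longer\<close>).  Competitors are only Lipschitz curves; the first section supplies
  the monotonicity principle and the arc length function for them.

  For the lift, take an elastica with tangent \<open>P\<close> and curvature \<open>k\<close>, and set \<open>b = - (1 + A + k\<^sup>2 / 2)\<close>.
  The triple \<open>(k, k', b)\<close> solves a linear system whose flow preserves the Lorentz form
  \<open>e\<^sup>2 - r\<^sup>2 - j\<^sup>2\<close>, and a pair \<open>(\<eta>, u)\<close> as above is the same as a null solution \<open>(e, r, j)\<close> with \<open>e \<noteq> 0\<close>, by
  \<open>\<eta> = e\<close> and \<open>\<eta> u = P (r + \<i> j)\<close>.  So a lift is a decomposition of \<open>(k, k', b)\<close> into two null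
  solutions.  An enlargement of the elastica by the factor \<open>\<lambda>\<close> divides \<open>A\<close> by \<open>\<lambda>\<^sup>2\<close>, and as soon as \<open>|A| < 1 / 2\<close>
  the triple is spacelike, of square \<open>- g\<^sup>2\<close>, say.  Half its sum and half its difference with a timelike
  solution of square \<open>g\<^sup>2\<close> orthogonal to it are the two null solutions.  A timelike solution of this kind
  is found by one quadrature (\<open>spacelike_split\<close>).  The two directions are always distinct, because
  otherwise \<open>(k, k', b)\<close> would itself be null.
\<close>

section \<open>Lipschitz functions of one real variable\<close>

lemma lipschitz_on_clamp:
  fixes f :: "real \<Rightarrow> 'a::metric_space"
  assumes "L-lipschitz_on {a..b} f" "a \<le> b"
  shows "L-lipschitz_on UNIV (\<lambda>s. f (max a (min b s)))"
proof (rule lipschitz_onI)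
  show "L \<ge> 0" using assms(1) lipschitz_on_nonneg by blast
  fix x y :: real
  have "dist (f (max a (min b x))) (f (max a (min b y))) \<le> L * dist (max a (min b x)) (max a (min b y))"
    using assms by (intro lipschitz_onD[OF assms(1)]) auto
  also have "\<dots> \<le> L * dist x y"
    using \<open>L \<ge> 0\<close> by (intro mult_left_mono) (auto simp: dist_real_def)
  finally show "dist (f (max a (min b x))) (f (max a (min b y))) \<le> L * dist x y" .
qed

text \<open>
  The clamped argument lets the quotients be formed on all of \<open>[a, b]\<close>, although \<open>f\<close> is
  controlled only there; near \<open>s < b\<close> the clamp is invisible.
\<close>

lemma has_vector_derivative_right_quotients:
  fixes f :: "real \<Rightarrow> 'a::real_normed_vector"
  assumes "(f has_vector_derivative D) (at s within {s..b})" "a \<le> s" "s < b"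
  shows "(\<lambda>n. (f (max a (min b (s + inverse (Suc n)))) - f s) /\<^sub>R inverse (Suc n)) \<longlonglongrightarrow> D"
proof -
  let ?e = "\<lambda>n. inverse (real (Suc n))"
  have "(f has_vector_derivative D) (at s within {s<..})"
  proof -
    have "(f has_vector_derivative D) (at s within {s<..<b})"
      using assms(1) by (rule has_vector_derivative_within_subset) auto
    moreover have "at s within {s<..<b} = at s within {s<..}"
      by (rule at_within_nhd[where S="{..<b}"]) (use assms(3) in auto)
    ultimately show ?thesis by simp
  qed
  then have lim: "((\<lambda>x. (f x - f s) /\<^sub>R (x - s)) \<longlongrightarrow> D) (at_right s)"
  proof -
    have "((\<lambda>y. (1 / norm (y - s)) *\<^sub>R (f y - (f s + (y - s) *\<^sub>R D))) \<longlongrightarrow> 0) (at_right s)"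
      using \<open>(f has_vector_derivative D) (at s within {s<..})\<close>
      by (simp add: has_vector_derivative_def has_derivative_within)
    moreover have "\<forall>\<^sub>F y in at_right s. (1 / norm (y - s)) *\<^sub>R (f y - (f s + (y - s) *\<^sub>R D))
        = (f y - f s) /\<^sub>R (y - s) - D"
      using eventually_at_right_less[of s]
      by eventually_elim (simp add: scaleR_diff_right scaleR_add_right divide_inverse)
    ultimately show ?thesis
      by (rule LIM_zero_cancel[OF Lim_transform_eventually])
  qed
  have "filterlim (\<lambda>n. s + ?e n) (at_right s) sequentially"
    using LIMSEQ_inverse_real_of_nat_add[of s]
    by (auto simp: filterlim_at eventually_sequentially)
  from filterlim_compose[OF lim this]
  have "(\<lambda>n. (f (s + ?e n) - f s) /\<^sub>R ?e n) \<longlonglongrightarrow> D" by simp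
  moreover have "\<forall>\<^sub>F n in sequentially. ?e n < b - s"
    using order_tendstoD(2)[OF LIMSEQ_inverse_real_of_nat, of "b - s"] assms(3) by simp
  then have "\<forall>\<^sub>F n in sequentially. (f (s + ?e n) - f s) /\<^sub>R ?e n
      = (f (max a (min b (s + ?e n))) - f s) /\<^sub>R ?e n"
    by eventually_elim (use assms in \<open>auto simp: min_def max_def add_increasing2\<close>)
  ultimately show ?thesis
    by (rule Lim_transform_eventually)
qed

text \<open>
  The forward difference quotients of \<open>h\<close> are bounded by \<open>L\<close>, so their integrals converge to the
  integral of the right derivative, which is nonpositive; on the other hand these integrals
  telescope and tend to \<open>h b - h a\<close>.  A bound on the quotients is essential: the Cantor function
  has zero derivative almost everywhere.
\<close>

lemma lipschitz_right_derivative_nonpos_imp_le: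
  fixes h :: "real \<Rightarrow> real"
  assumes "a \<le> b" and lip: "L-lipschitz_on {a..b} h" and N: "negligible N"
    and der: "\<And>s. s \<in> {a..<b} - N \<Longrightarrow> \<exists>D\<le>0. (h has_vector_derivative D) (at s within {s..b})"
  shows "h b \<le> h a"
proof (rule field_le_epsilon)
  define F where "F s = h (max a (min b s))" for s
  define e where "e n = inverse (real (Suc n))" for n
  define q where "q n s = (F (s + e n) - F s) / e n" for n s
  have e: "e n > 0" "e n \<le> 1" for n by (auto simp: e_def inverse_eq_divide)
  have e0: "e \<longlonglongrightarrow> 0" unfolding e_def by (rule LIMSEQ_inverse_real_of_nat)
  have L: "L \<ge> 0" using lip lipschitz_on_nonneg by blast
  have lipF: "L-lipschitz_on UNIV F"
    unfolding F_def by (rule lipschitz_on_clamp[OF lip \<open>a \<le> b\<close>])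
  have contF: "continuous_on S F" for S
    using lipschitz_on_continuous_on[OF lipF] continuous_on_subset by blast
  have intF: "F integrable_on {u..v}" for u v
    by (rule integrable_continuous_interval[OF contF])
  have contFe: "continuous_on S (\<lambda>s. F (s + e n))" for S n
    by (rule continuous_on_compose2[OF contF[of UNIV]]) (auto intro: continuous_intros)
  have intq: "q n integrable_on {a..b}" for n
    unfolding q_def using e[of n]
    by (intro integrable_continuous_interval continuous_intros contF contFe) auto
  obtain g where g: "\<And>s. s \<in> {a..<b} - N \<Longrightarrow> g s \<le> 0 \<and> (h has_vector_derivative g s) (at s within {s..b})"
    using der by metis
  let ?N = "insert b N"
  define g0 where "g0 s = (if s \<in> ?N then 0 else g s)" for s
  define q0 where "q0 n s = (if s \<in> ?N then 0 else q n s)" for n s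
  have N': "negligible ?N" using N by simp
  have intq0: "q0 n integrable_on {a..b}" "integral {a..b} (q0 n) = integral {a..b} (q n)" for n
    using integrable_spike[OF intq N', of "q0 n" n] integral_spike[OF N', of "{a..b}" "q0 n" "q n"]
    by (auto simp: q0_def)
  have bound: "norm (q n s) \<le> L" for n s
    using lipschitz_onD[OF lipF, of "s + e n" s] e(1)[of n]
    by (simp add: q_def dist_real_def divide_le_eq)
  have bound0: "norm (q0 n s) \<le> L" for n s
    using bound[of n s] L by (simp add: q0_def)
  have "(\<lambda>n. q0 n s) \<longlonglongrightarrow> g0 s" if "s \<in> {a..b}" for s
  proof (cases "s \<in> ?N")
    case False
    then have "s \<in> {a..<b} - N" using that by auto
    with has_vector_derivative_right_quotients[of h "g s" s b a] g[OF this] False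
    show ?thesis by (simp add: q0_def g0_def q_def F_def e_def divide_inverse_commute max_def)
  qed (simp add: q0_def g0_def)
  then have lim: "(\<lambda>n. integral {a..b} (q0 n)) \<longlonglongrightarrow> integral {a..b} g0" and "g0 integrable_on {a..b}"
    using dominated_convergence[of q0 "{a..b}" "\<lambda>_. L" g0] intq0(1) bound0
    by (simp_all add: integrable_const_ivl)
  then have "integral {a..b} g0 \<le> integral {a..b} (\<lambda>_. 0)"
    using g by (intro integral_le) (auto simp: g0_def)
  then have "integral {a..b} g0 \<le> 0" by simp
  fix \<epsilon> :: real assume "\<epsilon> > 0"
  \<comment> \<open>Beyond \<open>b\<close> the extension \<open>F\<close> is the constant \<open>h b\<close>, and on \<open>[a, a + e n]\<close> it exceeds \<open>h a\<close> by at most \<open>L * e n\<close>.\<close>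
  have low: "integral {a..b} (q n) \<ge> h b - h a - L * e n" for n
  proof -
    have shift: "integral {a..b} (\<lambda>s. F (s + e n)) = integral {a + e n..b + e n} F"
      using integral_shift_Icc_real[of a b F "e n"] by (simp add: o_def add.commute)
    have "integral {a..a + e n} F + integral {a + e n..b + e n} F
        = integral {a..b} F + integral {b..b + e n} F"
      using e(1)[of n] \<open>a \<le> b\<close>
      by (simp add: Henstock_Kurzweil_Integration.integral_combine intF)
    moreover have "integral {b..b + e n} F = integral {b..b + e n} (\<lambda>_. h b)"
      by (rule integral_cong) (use \<open>a \<le> b\<close> in \<open>auto simp: F_def min_def max_def\<close>)
    moreover have "integral {a..a + e n} F \<le> integral {a..a + e n} (\<lambda>_. h a + L * e n)"
    proof (rule integral_le)
      fix s assume "s \<in> {a..a + e n}"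
      then have "dist (F s) (F a) \<le> L * dist s a" "dist s a \<le> e n"
        using lipschitz_onD[OF lipF, of s a] by (auto simp: dist_real_def)
      then have "dist (F s) (F a) \<le> L * e n"
        using L by (meson mult_left_mono order_trans)
      then show "F s \<le> h a + L * e n"
        using \<open>a \<le> b\<close> by (auto simp: dist_real_def F_def)
    qed (auto intro: intF)
    moreover have "integral {a..b} (q n)
        = (integral {a..b} (\<lambda>s. F (s + e n)) - integral {a..b} F) / e n"
      unfolding q_def using integral_diff[OF integrable_continuous_interval[OF contFe] intF]
      by simp
    ultimately have "e n * (h b - h a - L * e n) \<le> e n * integral {a..b} (q n)"
      using e(1)[of n] shift by (simp add: field_simps)
    then show ?thesis
      using e(1)[of n] by simp
  qed
  have "(\<lambda>n. h b - h a - L * e n) \<longlonglongrightarrow> h b - h a - L * 0"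
    by (intro tendsto_intros e0)
  from LIMSEQ_le[OF this lim] low intq0 have "h b - h a \<le> integral {a..b} g0" by auto
  with \<open>integral {a..b} g0 \<le> 0\<close> \<open>\<epsilon> > 0\<close> show "h b \<le> h a + \<epsilon>" by simp
qed

text \<open>
  One-sided form of the Lebesgue differentiation theorem.  Right derivatives suffice here, since the
  monotonicity principle above asks for nothing more.
\<close>

lemma right_differentiable_integral:
  fixes f :: "real \<Rightarrow> real"
  assumes "f integrable_on {a..b}"
  obtains N where "negligible N"
    "\<And>s. s \<in> {a..<b} - N \<Longrightarrow> ((\<lambda>t. integral {a..t} f) has_vector_derivative f s) (at s within {s..b})"
proof -
  define g where "g s = (if s \<in> {a..b} then f s else 0)" for s
  have "g integrable_on cbox u v" for u v
    using integrable_on_subcbox[of g UNIV u v] assms integrable_restrict_UNIV[of "{a..b}" f]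
    by (simp add: g_def[abs_def])
  from integrable_ccontinuous_explicit[OF this]
  obtain N where N: "negligible N" and lim0: "\<And>x e. \<lbrakk>x \<notin> N; 0 < e\<rbrakk> \<Longrightarrow> \<exists>d>0. \<forall>h. 0 < h \<and> h < d \<longrightarrow>
        norm (integral (cbox x (x + h *\<^sub>R One)) g /\<^sub>R h ^ DIM(real) - g x) < e"
    by blast
  then have lim: "\<exists>d>0. \<forall>h. 0 < h \<and> h < d \<longrightarrow> norm (integral {x..x + h} g /\<^sub>R h - g x) < e"
    if "x \<notin> N" "0 < e" for x e
    using lim0[OF that] by simp
  have "((\<lambda>t. integral {a..t} f) has_vector_derivative f s) (at s within {s..b})" if s: "s \<in> {a..<b} - N" for s
    unfolding has_vector_derivative_def has_derivative_within_alt
  proof (intro conjI allI impI)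
    show "bounded_linear (\<lambda>x. x *\<^sub>R f s)" by (rule bounded_linear_scaleR_left)
    fix e :: real assume "e > 0"
    with lim[of s e] s obtain d where d: "d > 0"
      "\<And>h. 0 < h \<Longrightarrow> h < d \<Longrightarrow> norm (integral {s..s + h} g /\<^sub>R h - g s) < e" by auto
    have "norm (integral {a..y} f - integral {a..s} f - (y - s) *\<^sub>R f s) \<le> e * norm (y - s)"
      if y: "y \<in> {s..b}" "norm (y - s) < d" for y
    proof (cases "y = s")
      case False
      then have h: "0 < y - s" "y - s < d" using y by auto
      have "integral {a..y} f - integral {a..s} f = integral {s..y} f"
        using Henstock_Kurzweil_Integration.integral_combine[of a s y f] s y
          integrable_on_subinterval[OF assms, of a y] by auto
      also have "\<dots> = integral {s..y} g"
        using s y by (intro integral_cong) (auto simp: g_def)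
      finally have "integral {a..y} f - integral {a..s} f - (y - s) *\<^sub>R f s
          = (y - s) *\<^sub>R (integral {s..y} g /\<^sub>R (y - s) - g s)"
        using h s by (simp add: g_def right_diff_distrib mult.assoc[symmetric])
      then have "norm (integral {a..y} f - integral {a..s} f - (y - s) *\<^sub>R f s)
          = (y - s) * norm (integral {s..y} g /\<^sub>R (y - s) - g s)"
        using h(1) by (simp only: norm_scaleR abs_of_pos)
      also have "\<dots> \<le> (y - s) * e"
        using d(2)[OF h] h by (intro mult_left_mono) auto
      finally show ?thesis using h by (simp add: mult.commute)
    qed simp
    with \<open>d > 0\<close> show "\<exists>d>0. \<forall>y\<in>{s..b}. norm (y - s) < d \<longrightarrow>
        norm (integral {a..y} f - integral {a..s} f - (y - s) *\<^sub>R f s) \<le> e * norm (y - s)" by blast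
  qed
  with N show ?thesis using that by blast
qed

text \<open>
  The speed of a competitor may vanish on a large set, where differentiability says nothing about the
  curve reparametrized by arc length.  So the parameter is kept, and the arc length \<open>\<sigma>\<close> is recorded as
  a separate function.  The speed is integrable as an almost everywhere limit of the
  bounded continuous functions \<open>q n\<close>.
\<close>

lemma arc_length_function:
  fixes f :: "real \<Rightarrow> 'a::euclidean_space"
  assumes "a \<le> b" and lip: "L-lipschitz_on {a..b} f" and N: "negligible N"
    and der: "\<And>s. s \<in> {a..b} - N \<Longrightarrow> (f has_vector_derivative f' s) (at s within {a..b})"
  obtains \<sigma> N' where "negligible N'" "\<sigma> a = 0" "\<sigma> b = integral {a..b} (\<lambda>s. norm (f' s))"
    "L-lipschitz_on {a..b} \<sigma>" "mono_on {a..b} \<sigma>"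
    "\<And>s. s \<in> {a..<b} - N' \<Longrightarrow> (\<sigma> has_vector_derivative norm (f' s)) (at s within {s..b})"
proof -
  define F where "F s = f (max a (min b s))" for s
  define q where "q n s = norm ((F (s + inverse (Suc n)) - f s) /\<^sub>R inverse (Suc n))" for n s
  let ?N = "insert b N"
  have N': "negligible ?N" using N by simp
  have L: "L \<ge> 0" using lip lipschitz_on_nonneg by blast
  have lipF: "L-lipschitz_on UNIV F"
    unfolding F_def by (rule lipschitz_on_clamp[OF lip \<open>a \<le> b\<close>])
  define g0 where "g0 s = (if s \<in> ?N then 0 else norm (f' s))" for s
  define q0 where "q0 n s = (if s \<in> ?N then 0 else q n s)" for n s
  have q_int: "q n integrable_on {a..b}" for n
    unfolding q_def
    by (intro integrable_continuous_interval continuous_intros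
        continuous_on_compose2[OF lipschitz_on_continuous_on[OF lipF]]
        lipschitz_on_continuous_on[OF lip]) auto
  have q0_int: "q0 n integrable_on {a..b}" for n
    using integrable_spike[OF q_int N', of "q0 n" n] by (auto simp: q0_def)
  have q_bound: "norm (q n s) \<le> L" if "s \<in> {a..b}" for n s
  proof -
    have "f s = F s" using that by (simp add: F_def)
    moreover define e where "e = inverse (real (Suc n))"
    moreover have "e > 0" by (simp add: e_def)
    ultimately show ?thesis
      using lipschitz_onD[OF lipF, of "s + e" s]
      by (simp add: q_def dist_norm divide_inverse_commute[symmetric] pos_divide_le_eq del: of_nat_Suc flip: e_def)
  qed
  have lim: "(\<lambda>n. q0 n s) \<longlonglongrightarrow> g0 s" if "s \<in> {a..b}" for s
  proof (cases "s \<in> ?N")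
    case False
    then have s: "s \<in> {a..b} - N" "a \<le> s" "s < b" using that by auto
    have "(f has_vector_derivative f' s) (at s within {s..b})"
      using has_vector_derivative_within_subset[OF der[OF s(1)]] s by auto
    from tendsto_norm[OF has_vector_derivative_right_quotients[OF this s(2,3)]]
    show ?thesis using False by (simp add: q0_def g0_def q_def F_def)
  qed (simp add: q0_def g0_def)
  have g0_int: "g0 integrable_on {a..b}"
    using dominated_convergence(1)[of q0 "{a..b}" "\<lambda>_. L" g0, OF q0_int _ _ lim] q_bound L
    by (auto simp: q0_def integrable_const_ivl)
  have g0_le: "g0 s \<le> L" if "s \<in> {a..b}" for s
  proof (rule LIMSEQ_le_const2[OF lim[OF that]])
    have "q0 n s \<le> L" for n
      using q_bound[OF that, of n] L by (auto simp: q0_def)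
    then show "\<exists>N. \<forall>n\<ge>N. q0 n s \<le> L" by blast
  qed
  have g0_nonneg: "0 \<le> g0 s" for s by (simp add: g0_def)
  obtain N1 where N1: "negligible N1" and der0: "\<And>s. s \<in> {a..<b} - N1 \<Longrightarrow>
      ((\<lambda>t. integral {a..t} g0) has_vector_derivative g0 s) (at s within {s..b})"
    using right_differentiable_integral[OF g0_int] by blast
  have diff: "0 \<le> integral {a..t} g0 - integral {a..s} g0 \<and>
      integral {a..t} g0 - integral {a..s} g0 \<le> L * (t - s)"
    if "s \<in> {a..b}" "t \<in> {a..b}" "s \<le> t" for s t
  proof -
    have int: "g0 integrable_on {s..t}" "g0 integrable_on {a..t}"
      using integrable_on_subinterval[OF g0_int] that by auto
    have "integral {a..t} g0 - integral {a..s} g0 = integral {s..t} g0"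
      using Henstock_Kurzweil_Integration.integral_combine[of a s t g0] that int by auto
    moreover have "0 \<le> integral {s..t} g0"
      by (rule integral_nonneg[OF int(1)]) (rule g0_nonneg)
    moreover have "integral {s..t} g0 \<le> integral {s..t} (\<lambda>_. L)"
      by (rule integral_le[OF int(1)]) (use g0_le that in auto)
    ultimately show ?thesis using that by (simp add: mult.commute)
  qed
  show ?thesis
  proof (rule that[of "N \<union> N1" "\<lambda>t. integral {a..t} g0"])
    show "integral {a..b} g0 = integral {a..b} (\<lambda>s. norm (f' s))"
      by (rule integral_spike[OF N']) (simp add: g0_def)
    show "mono_on {a..b} (\<lambda>t. integral {a..t} g0)"
      by (rule mono_onI) (use diff in force)
    show "L-lipschitz_on {a..b} (\<lambda>t. integral {a..t} g0)"
    proof (rule lipschitz_onI[OF _ L])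
      fix s t assume "s \<in> {a..b}" "t \<in> {a..b}"
      then show "dist (integral {a..s} g0) (integral {a..t} g0) \<le> L * dist s t"
        using diff[of s t] diff[of t s] by (cases "s \<le> t") (auto simp: dist_real_def)
    qed
    fix s assume s: "s \<in> {a..<b} - (N \<union> N1)"
    then have "g0 s = norm (f' s)" by (simp add: g0_def)
    with der0[of s] s show "((\<lambda>t. integral {a..t} g0) has_vector_derivative norm (f' s)) (at s within {s..b})"
      by simp
  qed (use N N1 in auto)
qed

lemma (in bounded_bilinear) lipschitz_on_compact:
  assumes "L-lipschitz_on S f" "M-lipschitz_on S g" "compact S"
  shows "\<exists>K. K-lipschitz_on S (\<lambda>x. prod (f x) (g x))"
proof -
  have "bounded (f ` S)" "bounded (g ` S)"
    using assms by (auto intro: compact_imp_bounded compact_continuous_image lipschitz_on_continuous_on)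
  then obtain F G where F: "\<And>x. x \<in> S \<Longrightarrow> norm (f x) \<le> F" "F > 0" and G: "\<And>x. x \<in> S \<Longrightarrow> norm (g x) \<le> G" "G > 0"
    by (metis bounded_pos imageI)
  obtain B where B: "B > 0" "\<And>u v. norm (prod u v) \<le> norm u * norm v * B"
    using pos_bounded by blast
  have LM: "L \<ge> 0" "M \<ge> 0" using assms lipschitz_on_nonneg by blast+
  have "(F * M * B + L * G * B)-lipschitz_on S (\<lambda>x. prod (f x) (g x))"
  proof (rule lipschitz_onI)
    fix x y assume xy: "x \<in> S" "y \<in> S"
    have "prod (f x) (g x) - prod (f y) (g y) = prod (f x) (g x - g y) + prod (f x - f y) (g y)"
      by (simp add: diff_left diff_right)
    then have "dist (prod (f x) (g x)) (prod (f y) (g y))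
        \<le> norm (f x) * norm (g x - g y) * B + norm (f x - f y) * norm (g y) * B"
      unfolding dist_norm by (metis B(2) norm_triangle_mono)
    also have "\<dots> \<le> F * (M * dist x y) * B + (L * dist x y) * G * B"
      using F G B LM xy lipschitz_onD[OF assms(1) xy] lipschitz_onD[OF assms(2) xy]
      by (intro add_mono mult_right_mono mult_mono) (auto simp: dist_norm)
    finally show "dist (prod (f x) (g x)) (prod (f y) (g y)) \<le> (F * M * B + L * G * B) * dist x y"
      by (simp add: algebra_simps)
  qed (use F G B LM in simp)
  then show ?thesis by blast
qed

lemma lipschitz_on_bounded_vector_derivative:
  fixes f :: "real \<Rightarrow> 'a::real_normed_vector"
  assumes "\<And>s. s \<in> S \<Longrightarrow> (f has_vector_derivative f' s) (at s within J)" "S \<subseteq> J" "convex S"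
    and "\<And>s. s \<in> S \<Longrightarrow> norm (f' s) \<le> B" "B \<ge> 0"
  shows "B-lipschitz_on S f"
proof (rule bounded_derivative_imp_lipschitz)
  fix s assume s: "s \<in> S"
  show "(f has_derivative (\<lambda>x. x *\<^sub>R f' s)) (at s within S)"
    using has_vector_derivative_within_subset[OF assms(1)[OF s] assms(2)]
    by (simp add: has_vector_derivative_def)
  show "onorm (\<lambda>x. x *\<^sub>R f' s) \<le> B"
    using assms(4)[OF s] by (intro onorm_le) (simp add: mult.commute[of B] mult_left_mono)
qed (use assms in auto)

text \<open>
  Hiding the constant makes the property closed under sums and products, so that it can be
  checked syntactically.
\<close>

definition lipschitzable_on :: "'a::metric_space set \<Rightarrow> ('a \<Rightarrow> 'b::metric_space) \<Rightarrow> bool" where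
  "lipschitzable_on S f \<longleftrightarrow> (\<exists>L. L-lipschitz_on S f)"

lemma lipschitzable_onI: "L-lipschitz_on S f \<Longrightarrow> lipschitzable_on S f"
  by (auto simp: lipschitzable_on_def)

lemma lipschitzable_on_const: "lipschitzable_on S (\<lambda>x. c)"
  by (rule lipschitzable_onI[OF lipschitz_on_constant])

lemma lipschitzable_on_add:
  fixes f g :: "'a::metric_space \<Rightarrow> 'b::real_normed_vector"
  shows "lipschitzable_on S f \<Longrightarrow> lipschitzable_on S g \<Longrightarrow> lipschitzable_on S (\<lambda>x. f x + g x)"
  unfolding lipschitzable_on_def using lipschitz_on_add by blast

lemma lipschitzable_on_diff:
  fixes f g :: "'a::metric_space \<Rightarrow> 'b::real_normed_vector"
  shows "lipschitzable_on S f \<Longrightarrow> lipschitzable_on S g \<Longrightarrow> lipschitzable_on S (\<lambda>x. f x - g x)"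
  unfolding lipschitzable_on_def using lipschitz_on_diff by blast

lemma (in bounded_bilinear) lipschitzable_on_prod:
  "compact S \<Longrightarrow> lipschitzable_on S f \<Longrightarrow> lipschitzable_on S g \<Longrightarrow> lipschitzable_on S (\<lambda>x. prod (f x) (g x))"
  unfolding lipschitzable_on_def using lipschitz_on_compact by blast

lemma lipschitzable_on_compose:
  "lipschitzable_on S g \<Longrightarrow> g ` S \<subseteq> T \<Longrightarrow> lipschitzable_on T f \<Longrightarrow> lipschitzable_on S (\<lambda>x. f (g x))"
  unfolding lipschitzable_on_def
  by (blast intro: lipschitz_on_compose2 lipschitz_on_subset)

section \<open>One arm of the linkage\<close>

text \<open>
  If \<open>u = cis (\<alpha> + \<delta>)\<close> and \<open>U = cis \<alpha>\<close>, then \<open>u \<bullet> U = cos \<delta>\<close> and \<open>u \<bullet> (\<i> * U) = sin \<delta>\<close>.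
\<close>

lemma unit_arm:
  fixes u U :: complex
  assumes "norm u = 1" "norm U = 1"
  shows "(norm (u - U))\<^sup>2 = 2 * (1 - u \<bullet> U)"
    and "(u \<bullet> U)\<^sup>2 + (u \<bullet> (\<i> * U))\<^sup>2 = 1"
    and "\<bar>u \<bullet> (\<i> * U)\<bar> \<le> norm (u - U)"
    and "(u \<bullet> U) *\<^sub>R (\<i> * u) - \<i> * U = - (u \<bullet> (\<i> * U)) *\<^sub>R u"
proof -
  have u: "(Re u)\<^sup>2 + (Im u)\<^sup>2 = 1" and U: "(Re U)\<^sup>2 + (Im U)\<^sup>2 = 1"
    using assms by (simp_all add: cmod_def)
  show 1: "(norm (u - U))\<^sup>2 = 2 * (1 - u \<bullet> U)"
    using u U unfolding cmod_power2 inner_complex_def minus_complex.sel by algebra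
  show 2: "(u \<bullet> U)\<^sup>2 + (u \<bullet> (\<i> * U))\<^sup>2 = 1"
    using u U unfolding inner_complex_def by simp algebra
  have "(u \<bullet> (\<i> * U))\<^sup>2 \<le> (norm (u - U))\<^sup>2"
    using 1 2 sum_power2_ge_zero[of "u \<bullet> U - 1" 0] by (simp add: power2_eq_square algebra_simps)
  then show "\<bar>u \<bullet> (\<i> * U)\<bar> \<le> norm (u - U)"
    by (metis abs_le_square_iff abs_norm_cancel)
  show "(u \<bullet> U) *\<^sub>R (\<i> * u) - \<i> * U = - (u \<bullet> (\<i> * U)) *\<^sub>R u"
    using u by (auto simp: complex_eq_iff inner_complex_def) algebra+
qed

text \<open>
  Apart from \<open>- C / 2\<close> times the squared displacement, each arm contributes this expression to
  \<open>\<partial>\<^sub>t S + \<langle>P, \<nabla> S\<rangle>\<close> for the calibrating function \<open>S\<close> below, with \<open>k = C (t - t\<^sub>0)\<close>.  It is of second order in \<open>u - U\<close>: the terms of first order cancel because the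
  reference arm \<open>U\<close> obeys the Hamiltonian equations.
\<close>

lemma arm_rate_bound:
  fixes P u U :: complex
  assumes "norm P = 1" "norm u = 1" "norm U = 1" "\<bar>\<eta>\<bar> \<le> M" "\<bar>k\<bar> \<le> 1"
  shows "\<eta> * (P \<bullet> U) * (u \<bullet> (\<i> * U)) - \<eta> * (P \<bullet> (\<i> * U)) * (u \<bullet> U) + k * (u \<bullet> (\<i> * U)) * (P \<bullet> (\<i> * U))
     + P \<bullet> ((\<eta> * (u \<bullet> U)) *\<^sub>R (\<i> * u) - (k * (u \<bullet> (\<i> * U))) *\<^sub>R (\<i> * u))
     \<le> (M + 1) * (norm (u - U))\<^sup>2"
proof -
  define a b c s where "a = P \<bullet> U" and "b = P \<bullet> (\<i> * U)" and "c = u \<bullet> U" and "s = u \<bullet> (\<i> * U)"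
  define e where "e = norm (u - U)"
  have U: "(Re U)\<^sup>2 + (Im U)\<^sup>2 = 1" using assms by (simp add: cmod_def)
  have Piu: "P \<bullet> (\<i> * u) = c * b - s * a"
    using U unfolding a_def b_def c_def s_def inner_complex_def by simp algebra
  have ab: "a\<^sup>2 + b\<^sup>2 = 1" and cs: "c\<^sup>2 + s\<^sup>2 = 1"
    using unit_arm(2)[OF assms(1,3)] unit_arm(2)[OF assms(2,3)] by (auto simp: a_def b_def c_def s_def)
  have e: "e\<^sup>2 = 2 * (1 - c)" "\<bar>s\<bar> \<le> e" "e \<ge> 0"
    using unit_arm(1,3)[OF assms(2,3)] by (auto simp: c_def s_def e_def)
  have "(a * s - b * c)\<^sup>2 + (a * c + b * s)\<^sup>2 = 1" using ab cs by algebra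
  then have "(a * s - b * c)\<^sup>2 \<le> 1" by (metis le_add_same_cancel1 zero_le_power2)
  then have "\<bar>a * s - b * c\<bar> \<le> 1" by (simp add: abs_square_le_1)
  then have "\<bar>\<eta> * (a * s - b * c)\<bar> \<le> M * 1"
    unfolding abs_mult using assms by (intro mult_mono) auto
  then have "\<eta> * (a * s - b * c) * (e\<^sup>2 / 2) \<le> M * (e\<^sup>2 / 2)"
    by (intro mult_right_mono) auto
  also have "\<dots> \<le> M * e\<^sup>2" using assms by (auto intro!: mult_left_mono)
  finally have 1: "\<eta> * (a * s - b * c) * (1 - c) \<le> M * e\<^sup>2"
    using e(1) by (metis mult.commute nonzero_mult_div_cancel_right zero_neq_numeral)
  have "(b * (1 - c) + s * a)\<^sup>2 + (a * (1 - c) - s * b)\<^sup>2 = e\<^sup>2"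
    unfolding e(1) using ab cs by algebra
  then have "(b * (1 - c) + s * a)\<^sup>2 \<le> e\<^sup>2" by (metis le_add_same_cancel1 zero_le_power2)
  then have "\<bar>b * (1 - c) + s * a\<bar> \<le> e" using e(3) by (metis abs_le_square_iff abs_of_nonneg)
  then have "\<bar>k\<bar> * (\<bar>s\<bar> * \<bar>b * (1 - c) + s * a\<bar>) \<le> 1 * (e * e)"
    using assms e by (intro mult_mono) auto
  then have "k * (s * (b * (1 - c) + s * a)) \<le> e\<^sup>2"
    by (metis abs_mult abs_le_D1 mult_1 power2_eq_square)
  with 1 have "\<eta> * (a * s - b * c) * (1 - c) + k * (s * (b * (1 - c) + s * a)) \<le> (M + 1) * e\<^sup>2"
    by (simp add: algebra_simps)
  then show ?thesis
    unfolding inner_diff_right inner_scaleR_right Piu a_def[symmetric] b_def[symmetric] c_def[symmetric]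
      s_def[symmetric] e_def[symmetric]
    by (simp add: algebra_simps power2_eq_square)
qed

text \<open>
  The condition that \<open>m\<close> moves along the arm leaves the factor \<open>r\<close> open; the constant length of the arm
  determines it as \<open>Q \<bullet> u\<close>, so the arm turns by the component of \<open>Q\<close> orthogonal to it.
\<close>

lemma rolling_arm_derivative:
  fixes x m :: "real \<Rightarrow> complex"
  assumes "a < b" "s \<in> {a..b}" and unit: "\<And>s. s \<in> {a..b} \<Longrightarrow> norm (x s - m s) = 1"
    and x: "(x has_vector_derivative Q) (at s within {a..b})"
    and m: "(m has_vector_derivative r *\<^sub>R (x s - m s)) (at s within {a..b})"
  shows "((\<lambda>s. x s - m s) has_vector_derivative (Q \<bullet> (\<i> * (x s - m s))) *\<^sub>R (\<i> * (x s - m s)))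
    (at s within {a..b})"
proof -
  define u where "u s = x s - m s" for s
  have u: "(u has_vector_derivative Q - r *\<^sub>R u s) (at s within {a..b})"
    unfolding u_def by (intro has_vector_derivative_diff x m)
  have sq: "u t \<bullet> u t = 1" if "t \<in> {a..b}" for t
    using unit[OF that] by (simp add: u_def norm_eq_1)
  have "((\<lambda>s. u s \<bullet> u s) has_vector_derivative u s \<bullet> (Q - r *\<^sub>R u s) + (Q - r *\<^sub>R u s) \<bullet> u s) (at s within {a..b})"
    by (rule bounded_bilinear.has_vector_derivative[OF bounded_bilinear_inner u u])
  moreover have "((\<lambda>s. u s \<bullet> u s) has_vector_derivative 0) (at s within {a..b})"
    by (rule has_vector_derivative_transform[OF assms(2) _ has_vector_derivative_const[of 1]]) (simp add: sq)
  ultimately have "u s \<bullet> (Q - r *\<^sub>R u s) + (Q - r *\<^sub>R u s) \<bullet> u s = 0"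
    using vector_derivative_unique_within_closed_interval[of a b s] assms(1,2) by (metis box_real(2))
  then have r: "r = Q \<bullet> u s"
    using sq[OF assms(2)] by (simp add: inner_diff_left inner_diff_right inner_commute)
  have "(Re (u s))\<^sup>2 + (Im (u s))\<^sup>2 = 1"
    using sq[OF assms(2)] by (simp add: inner_complex_def power2_eq_square)
  then have "Q - r *\<^sub>R u s = (Q \<bullet> (\<i> * u s)) *\<^sub>R (\<i> * u s)"
    unfolding r by (auto simp: complex_eq_iff inner_complex_def) algebra+
  with u show ?thesis by (simp add: u_def[abs_def])
qed

section \<open>Normal extremals are geodesics\<close>

text \<open>
  The trajectories of the Hamiltonian system with \<open>H = 1/2\<close>.  Here \<open>P\<close> is the velocity of \<open>X\<close>, the vectors
  \<open>U1\<close> and \<open>U2\<close> are \<open>cis \<alpha>\<^sub>1\<close> and \<open>cis \<alpha>\<^sub>2\<close>, and \<open>(p, \<eta>1, \<eta>2)\<close> are the conjugate momenta.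
\<close>

locale normal_extremal =
  fixes J :: "real set" and p :: complex and X P U1 U2 :: "real \<Rightarrow> complex" and \<eta>1 \<eta>2 :: "real \<Rightarrow> real"
  assumes interval: "is_interval J"
    and X': "\<And>t. t \<in> J \<Longrightarrow> (X has_vector_derivative P t) (at t within J)"
    and P_unit: "\<And>t. t \<in> J \<Longrightarrow> norm (P t) = 1"
    and U_unit: "\<And>t. t \<in> J \<Longrightarrow> norm (U1 t) = 1" "\<And>t. t \<in> J \<Longrightarrow> norm (U2 t) = 1"
    and U1': "\<And>t. t \<in> J \<Longrightarrow>
      (U1 has_vector_derivative (P t \<bullet> (\<i> * U1 t)) *\<^sub>R (\<i> * U1 t)) (at t within J)"
    and U2': "\<And>t. t \<in> J \<Longrightarrow>
      (U2 has_vector_derivative (P t \<bullet> (\<i> * U2 t)) *\<^sub>R (\<i> * U2 t)) (at t within J)"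
    and \<eta>1': "\<And>t. t \<in> J \<Longrightarrow> (\<eta>1 has_vector_derivative \<eta>1 t * (P t \<bullet> U1 t)) (at t within J)"
    and \<eta>2': "\<And>t. t \<in> J \<Longrightarrow> (\<eta>2 has_vector_derivative \<eta>2 t * (P t \<bullet> U2 t)) (at t within J)"
    and P_eq: "\<And>t. t \<in> J \<Longrightarrow> P t = p + \<i> * (\<eta>1 t *\<^sub>R U1 t + \<eta>2 t *\<^sub>R U2 t)"
    and U_neq: "\<And>t. t \<in> J \<Longrightarrow> U1 t \<noteq> U2 t"
begin

definition dev :: "real \<Rightarrow> complex \<Rightarrow> complex \<Rightarrow> complex \<Rightarrow> real" where
  "dev t x u1 u2 = (norm (x - X t))\<^sup>2 + (norm (u1 - U1 t))\<^sup>2 + (norm (u2 - U2 t))\<^sup>2"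

text \<open>
  The calibrating function \<open>S(t, q)\<close> at the linkage \<open>q = (x, x - u1, x - u2)\<close>.  Its first part has the momenta
  as differential at the extremal, the angle between \<open>u\<^sub>j\<close> and \<open>U\<^sub>j\<close> being replaced by its sine.
\<close>

definition calib :: "real \<Rightarrow> real \<Rightarrow> real \<Rightarrow> complex \<Rightarrow> complex \<Rightarrow> complex \<Rightarrow> real" where
  "calib C t0 t x u1 u2 = p \<bullet> (x - X t) + \<eta>1 t * (u1 \<bullet> (\<i> * U1 t)) + \<eta>2 t * (u2 \<bullet> (\<i> * U2 t))
     - C * (t - t0) / 2 * dev t x u1 u2"

text \<open>
  The horizontal gradient: a horizontal motion with \<open>x' = Q\<close> changes \<open>S\<close> at the rate
  \<open>Q \<bullet> calib_grad\<close>, and the passage of time changes it at the rate \<open>calib_dt\<close> defined next.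
\<close>

definition calib_grad :: "real \<Rightarrow> real \<Rightarrow> real \<Rightarrow> complex \<Rightarrow> complex \<Rightarrow> complex \<Rightarrow> complex" where
  "calib_grad C t0 t x u1 u2 =
     p + (\<eta>1 t * (u1 \<bullet> U1 t)) *\<^sub>R (\<i> * u1) + (\<eta>2 t * (u2 \<bullet> U2 t)) *\<^sub>R (\<i> * u2)
     - (C * (t - t0)) *\<^sub>R (x - X t + (u1 \<bullet> (\<i> * U1 t)) *\<^sub>R (\<i> * u1) + (u2 \<bullet> (\<i> * U2 t)) *\<^sub>R (\<i> * u2))"

definition calib_dt :: "real \<Rightarrow> real \<Rightarrow> real \<Rightarrow> complex \<Rightarrow> complex \<Rightarrow> complex \<Rightarrow> real" where
  "calib_dt C t0 t x u1 u2 = - (p \<bullet> P t)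
     + \<eta>1 t * (P t \<bullet> U1 t) * (u1 \<bullet> (\<i> * U1 t)) - \<eta>1 t * (P t \<bullet> (\<i> * U1 t)) * (u1 \<bullet> U1 t)
     + \<eta>2 t * (P t \<bullet> U2 t) * (u2 \<bullet> (\<i> * U2 t)) - \<eta>2 t * (P t \<bullet> (\<i> * U2 t)) * (u2 \<bullet> U2 t)
     - C / 2 * dev t x u1 u2
     + C * (t - t0) * ((x - X t) \<bullet> P t + (u1 \<bullet> (\<i> * U1 t)) * (P t \<bullet> (\<i> * U1 t))
         + (u2 \<bullet> (\<i> * U2 t)) * (P t \<bullet> (\<i> * U2 t)))"

lemma calib_self: "t \<in> J \<Longrightarrow> calib C t0 t (X t) (U1 t) (U2 t) = 0"
  by (simp add: calib_def dev_def inner_complex_def)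

lemma calib_has_vector_derivative:
  assumes \<sigma>: "(\<sigma> has_vector_derivative v) (at s within A)" "\<sigma> ` A \<subseteq> J" "s \<in> A"
    and x: "(x has_vector_derivative Q) (at s within A)"
    and u1: "(u1 has_vector_derivative (Q \<bullet> (\<i> * u1 s)) *\<^sub>R (\<i> * u1 s)) (at s within A)"
    and u2: "(u2 has_vector_derivative (Q \<bullet> (\<i> * u2 s)) *\<^sub>R (\<i> * u2 s)) (at s within A)"
  shows "((\<lambda>s. calib C t0 (\<sigma> s) (x s) (u1 s) (u2 s)) has_vector_derivative
     v * calib_dt C t0 (\<sigma> s) (x s) (u1 s) (u2 s) + Q \<bullet> calib_grad C t0 (\<sigma> s) (x s) (u1 s) (u2 s))
     (at s within A)"
proof -
  have sJ: "\<sigma> s \<in> J" using \<sigma> by auto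
  have chain: "((\<lambda>s. f (\<sigma> s)) has_vector_derivative v *\<^sub>R f') (at s within A)"
    if "(f has_vector_derivative f') (at (\<sigma> s) within J)" for f :: "real \<Rightarrow> 'b::real_normed_vector" and f'
    using vector_diff_chain_within[OF \<sigma>(1) has_vector_derivative_within_subset[OF that \<sigma>(2)]]
    by (simp add: o_def)
  note D = chain[OF X'[OF sJ]] chain[OF U1'[OF sJ]] chain[OF U2'[OF sJ]]
    chain[OF \<eta>1'[OF sJ]] chain[OF \<eta>2'[OF sJ]]
  note I = bounded_bilinear.has_vector_derivative[OF bounded_bilinear_inner]
  show ?thesis
    unfolding calib_def dev_def power2_norm_eq_inner
    apply (rule has_vector_derivative_eq_rhs)
     apply (rule D \<sigma> x u1 u2 I has_vector_derivative_add has_vector_derivative_diff has_vector_derivative_mult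
       has_vector_derivative_const has_vector_derivative_mult_right has_vector_derivative_divide)+
    unfolding calib_dt_def calib_grad_def dev_def power2_norm_eq_inner
    by (simp add: inner_complex_def algebra_simps add_divide_distrib diff_divide_distrib)
qed

text \<open>
  On the extremal the gradient is \<open>P\<close>, since there the momenta give back the velocity.
\<close>

lemma calib_grad_diff:
  assumes "t \<in> J" "norm u1 = 1" "norm u2 = 1" "\<bar>\<eta>1 t\<bar> \<le> M" "\<bar>\<eta>2 t\<bar> \<le> M" "\<bar>C * (t - t0)\<bar> \<le> 1"
  shows "norm (calib_grad C t0 t x u1 u2 - P t) \<le> (M + 1) * (norm (x - X t) + norm (u1 - U1 t) + norm (u2 - U2 t))"
proof -
  define k s1 s2 where "k = C * (t - t0)" and "s1 = u1 \<bullet> (\<i> * U1 t)" and "s2 = u2 \<bullet> (\<i> * U2 t)"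
  have e: "calib_grad C t0 t x u1 u2 - P t
     = \<eta>1 t *\<^sub>R ((u1 \<bullet> U1 t) *\<^sub>R (\<i> * u1) - \<i> * U1 t) + \<eta>2 t *\<^sub>R ((u2 \<bullet> U2 t) *\<^sub>R (\<i> * u2) - \<i> * U2 t)
       - k *\<^sub>R (x - X t) - (k * s1) *\<^sub>R (\<i> * u1) - (k * s2) *\<^sub>R (\<i> * u2)"
    unfolding calib_grad_def k_def s1_def s2_def P_eq[OF assms(1)]
    by (simp add: algebra_simps scaleR_add_right scaleR_diff_right)
  also have "\<dots> = (- \<eta>1 t * s1) *\<^sub>R u1 + (- \<eta>2 t * s2) *\<^sub>R u2
       - k *\<^sub>R (x - X t) - (k * s1) *\<^sub>R (\<i> * u1) - (k * s2) *\<^sub>R (\<i> * u2)"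
    unfolding unit_arm(4)[OF assms(2) U_unit(1)[OF assms(1)]] unit_arm(4)[OF assms(3) U_unit(2)[OF assms(1)]]
    by (simp add: s1_def s2_def)
  also have "norm \<dots> \<le> norm ((- \<eta>1 t * s1) *\<^sub>R u1) + norm ((- \<eta>2 t * s2) *\<^sub>R u2)
       + norm (k *\<^sub>R (x - X t)) + norm ((k * s1) *\<^sub>R (\<i> * u1)) + norm ((k * s2) *\<^sub>R (\<i> * u2))"
    by (intro norm_triangle_le_diff norm_triangle_le add_mono order_refl)
  also have "\<dots> = (\<bar>\<eta>1 t\<bar> + \<bar>k\<bar>) * \<bar>s1\<bar> + (\<bar>\<eta>2 t\<bar> + \<bar>k\<bar>) * \<bar>s2\<bar> + \<bar>k\<bar> * norm (x - X t)"
    using assms(2,3) by (simp add: abs_mult norm_mult distrib_right)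
  also have "\<dots> \<le> (M + 1) * norm (u1 - U1 t) + (M + 1) * norm (u2 - U2 t) + (M + 1) * norm (x - X t)"
    using assms unit_arm(3)[OF assms(2) U_unit(1)[OF assms(1)]] unit_arm(3)[OF assms(3) U_unit(2)[OF assms(1)]]
    by (intro add_mono mult_mono) (auto simp: k_def s1_def s2_def)
  finally show ?thesis by (simp add: algebra_simps)
qed

text \<open>
  Since \<open>P\<close> has norm one, \<open>|V| \<le> (1 + |V|\<^sup>2) / 2 = \<langle>P, V\<rangle> + |V - P|\<^sup>2 / 2\<close> for \<open>V = \<nabla> S\<close>.  Both
  \<open>\<partial>\<^sub>t S + \<langle>P, V\<rangle> + C dev / 2\<close> and \<open>|V - P|\<^sup>2 / 2\<close> are bounded by multiples of \<open>dev\<close> that depend on \<open>M\<close> only, and the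
  bound on \<open>C\<close> is the sum of these multiples, doubled.
\<close>

lemma calib_subsolution:
  assumes "t \<in> J" "norm u1 = 1" "norm u2 = 1" "\<bar>\<eta>1 t\<bar> \<le> M" "\<bar>\<eta>2 t\<bar> \<le> M" "\<bar>C * (t - t0)\<bar> \<le> 1"
    and C: "C \<ge> 2 * (M + 1) + 3 * (M + 1)\<^sup>2"
  shows "calib_dt C t0 t x u1 u2 + norm (calib_grad C t0 t x u1 u2) \<le> 0"
proof -
  define V where "V = calib_grad C t0 t x u1 u2"
  define D where "D = dev t x u1 u2"
  let ?e0 = "norm (x - X t)" and ?e1 = "norm (u1 - U1 t)" and ?e2 = "norm (u2 - U2 t)"
  have "calib_dt C t0 t x u1 u2 + P t \<bullet> V \<le> (M + 1) * ?e1\<^sup>2 + (M + 1) * ?e2\<^sup>2 - C / 2 * D"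
    using arm_rate_bound[OF P_unit[OF assms(1)] assms(2) U_unit(1)[OF assms(1)] assms(4,6)]
      arm_rate_bound[OF P_unit[OF assms(1)] assms(3) U_unit(2)[OF assms(1)] assms(5,6)]
    unfolding calib_dt_def V_def calib_grad_def D_def
    by (simp add: algebra_simps inner_commute[of p] inner_commute[of x] inner_commute[of "X t"])
  also have "\<dots> \<le> (M + 1) * D - C / 2 * D"
    using assms(4) unfolding D_def dev_def by (simp add: distrib_left)
  finally have 1: "calib_dt C t0 t x u1 u2 + P t \<bullet> V \<le> (M + 1) * D - C / 2 * D" .
  have "(norm (V - P t))\<^sup>2 \<le> ((M + 1) * (?e0 + ?e1 + ?e2))\<^sup>2"
    unfolding V_def by (rule power_mono[OF calib_grad_diff[OF assms(1-6)]]) simp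
  also have "\<dots> = (M + 1)\<^sup>2 * (?e0 + ?e1 + ?e2)\<^sup>2" by (simp add: power_mult_distrib)
  also have "\<dots> \<le> (M + 1)\<^sup>2 * (3 * D)"
  proof (rule mult_left_mono)
    have "0 \<le> (?e0 - ?e1)\<^sup>2 + (?e1 - ?e2)\<^sup>2 + (?e2 - ?e0)\<^sup>2" by simp
    then show "(?e0 + ?e1 + ?e2)\<^sup>2 \<le> 3 * D"
      unfolding D_def dev_def by (simp add: power2_eq_square algebra_simps)
  qed simp
  finally have 2: "(norm (V - P t))\<^sup>2 \<le> 3 * (M + 1)\<^sup>2 * D" by simp
  have "(norm (V - P t))\<^sup>2 = (norm V)\<^sup>2 - 2 * (P t \<bullet> V) + 1"
    using P_unit[OF assms(1)]
    by (simp add: power2_norm_eq_inner inner_diff_left inner_diff_right inner_commute flip: norm_eq_1)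
  moreover have "2 * norm V \<le> 1 + (norm V)\<^sup>2"
    using zero_le_power2[of "norm V - 1"] by (simp add: power2_eq_square algebra_simps)
  ultimately have "norm V \<le> P t \<bullet> V + 3 / 2 * (M + 1)\<^sup>2 * D" using 2 by simp
  with 1 have "calib_dt C t0 t x u1 u2 + norm V \<le> (2 * (M + 1) + 3 * (M + 1)\<^sup>2 - C) / 2 * D"
    by (simp add: algebra_simps)
  also have "\<dots> \<le> 0"
    using C by (intro mult_nonpos_nonneg) (auto simp: D_def dev_def)
  finally show ?thesis by (simp add: V_def)
qed

definition lift :: "real \<Rightarrow> linkage" where
  "lift t = (X t, X t - U1 t, X t - U2 t)"

lemma X_lipschitz: "S \<subseteq> J \<Longrightarrow> convex S \<Longrightarrow> 1-lipschitz_on S X"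
  by (rule lipschitz_on_bounded_vector_derivative[OF X']) (auto simp: P_unit subset_iff)

lemma U_lipschitz:
  assumes "S \<subseteq> J" "convex S"
  shows "1-lipschitz_on S U1" "1-lipschitz_on S U2"
proof -
  have *: "norm ((P t \<bullet> (\<i> * u)) *\<^sub>R (\<i> * u)) \<le> 1" if "t \<in> J" "norm u = 1" for t u
    using Cauchy_Schwarz_ineq2[of "P t" "\<i> * u"] that P_unit[OF that(1)] by (simp add: norm_mult)
  show "1-lipschitz_on S U1"
    by (rule lipschitz_on_bounded_vector_derivative[OF U1' assms]) (use assms * U_unit in auto)
  show "1-lipschitz_on S U2"
    by (rule lipschitz_on_bounded_vector_derivative[OF U2' assms]) (use assms * U_unit in auto)
qed

lemma \<eta>_lipschitz:
  assumes "S \<subseteq> J" "convex S" "\<And>t. t \<in> S \<Longrightarrow> \<bar>\<eta>1 t\<bar> \<le> M \<and> \<bar>\<eta>2 t\<bar> \<le> M" "M \<ge> 0"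
  shows "M-lipschitz_on S \<eta>1" "M-lipschitz_on S \<eta>2"
proof -
  have *: "norm (e * (P t \<bullet> u)) \<le> M" if "t \<in> J" "norm u = 1" "\<bar>e\<bar> \<le> M" for t u and e :: real
  proof -
    have "\<bar>e\<bar> * \<bar>P t \<bullet> u\<bar> \<le> M * 1"
      using Cauchy_Schwarz_ineq2[of "P t" u] that P_unit[OF that(1)] by (intro mult_mono) auto
    then show ?thesis by (simp add: abs_mult)
  qed
  show "M-lipschitz_on S \<eta>1"
    by (rule lipschitz_on_bounded_vector_derivative[OF \<eta>1' assms(1,2)]) (use assms * U_unit in auto)
  show "M-lipschitz_on S \<eta>2"
    by (rule lipschitz_on_bounded_vector_derivative[OF \<eta>2' assms(1,2)]) (use assms * U_unit in auto)
qed

text \<open>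
  The rolling rule for \<open>U\<close> is the statement that \<open>X - U\<close> moves along the arm, with speed \<open>P \<bullet> U\<close>.
\<close>

lemma horizontal_lift: "horizontal_on J lift"
  unfolding horizontal_on_def
proof (intro conjI allI impI)
  show "lift \<in> J \<rightarrow> config_space"
    using U_unit U_neq by (auto simp: lift_def config_space_def dist_norm)
  fix a b :: real assume "{a..b} \<subseteq> J"
  then show "\<exists>L. L-lipschitz_on {a..b} lift"
    unfolding lift_def[abs_def]
    using lipschitz_on_Pair[OF X_lipschitz lipschitz_on_Pair[OF lipschitz_on_diff[OF X_lipschitz U_lipschitz(1)]
        lipschitz_on_diff[OF X_lipschitz U_lipschitz(2)]], of "{a..b}"]
    by auto
next
  have r: "P t - (P t \<bullet> (\<i> * u)) *\<^sub>R (\<i> * u) = (P t \<bullet> u) *\<^sub>R (X t - (X t - u))" if "norm u = 1" for t u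
  proof -
    have "(Re u)\<^sup>2 + (Im u)\<^sup>2 = 1" using that by (simp add: cmod_def)
    then show ?thesis by (auto simp: complex_eq_iff inner_complex_def) algebra+
  qed
  have "\<exists>x m1 m2 x' m1' m2'. lift t = (x, m1, m2) \<and>
          (lift has_vector_derivative (x', m1', m2')) (at t within J) \<and>
          (\<exists>r1::real. m1' = r1 *\<^sub>R (x - m1)) \<and> (\<exists>r2::real. m2' = r2 *\<^sub>R (x - m2))" if "t \<in> J" for t
  proof -
    have "(lift has_vector_derivative (P t, P t - (P t \<bullet> (\<i> * U1 t)) *\<^sub>R (\<i> * U1 t),
        P t - (P t \<bullet> (\<i> * U2 t)) *\<^sub>R (\<i> * U2 t))) (at t within J)"
      unfolding lift_def[abs_def]
      by (intro has_vector_derivative_Pair has_vector_derivative_diff X' U1' U2' that)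
    then show ?thesis
      using r[OF U_unit(1)[OF that], of t] r[OF U_unit(2)[OF that], of t] by (auto simp: lift_def)
  qed
  then show "\<exists>N. negligible N \<and> (\<forall>t\<in>J - N. \<exists>x m1 m2 x' m1' m2'. lift t = (x, m1, m2) \<and>
          (lift has_vector_derivative (x', m1', m2')) (at t within J) \<and>
          (\<exists>r1::real. m1' = r1 *\<^sub>R (x - m1)) \<and> (\<exists>r2::real. m2' = r2 *\<^sub>R (x - m2)))"
    by (intro exI[of _ "{}"]) auto
qed

lemma linkage_length_lift:
  assumes "a \<le> b" "{a..b} \<subseteq> J"
  shows "linkage_length a b lift = b - a"
proof (cases "a < b")
  case True
  have "link_x \<circ> lift = X" by (auto simp: lift_def link_x_def)
  moreover have "norm (vector_derivative X (at t within {a..b})) = 1" if "t \<in> {a..b}" for t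
    using vector_derivative_within_closed_interval[OF True that
        has_vector_derivative_within_subset[OF X' assms(2)]] that assms P_unit by auto
  ultimately have "linkage_length a b lift = integral {a..b} (\<lambda>_. 1)"
    unfolding linkage_length_def by (metis (no_types, lifting) integral_cong)
  then show ?thesis using assms by simp
qed (use assms in \<open>simp add: linkage_length_def\<close>)

text \<open>
  Along the competitor with the clock \<open>\<tau> = a + \<sigma>\<close> the rate of change of \<open>S\<close> is
  \<open>|Q| \<partial>\<^sub>t S + \<langle>Q, \<nabla> S\<rangle> \<le> |Q| (\<partial>\<^sub>t S + |\<nabla> S|) \<le> 0\<close>.  The subsolution inequality holds for all linkages,
  so competitors that leave every neighbourhood of the extremal are covered as well.
\<close>

lemma calib_competitor:
  assumes ab: "a' \<le> b'" and hor: "horizontal_on {a'..b'} d" and start: "d a' = lift a"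
    and l: "l = linkage_length a' b' d" and lb: "a + l \<le> b" "a \<le> b" and J: "{a..b} \<subseteq> J"
    and M: "\<And>t. t \<in> {a..b} \<Longrightarrow> \<bar>\<eta>1 t\<bar> \<le> M \<and> \<bar>\<eta>2 t\<bar> \<le> M" "\<And>t. t \<in> {a..b} \<Longrightarrow> \<bar>C * (t - t0)\<bar> \<le> 1"
    and C: "C \<ge> 2 * (M + 1) + 3 * (M + 1)\<^sup>2"
    and end': "d b' = (x', x' - v1, x' - v2)"
  shows "calib C t0 (a + l) x' v1 v2 \<le> 0"
proof (cases "a' = b'")
  case True
  then have "l = 0" by (simp add: l linkage_length_def)
  moreover have "x' = X a" "v1 = U1 a" "v2 = U2 a"
    using True start end' by (auto simp: lift_def)
  ultimately show ?thesis using calib_self[of a] J lb by auto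
next
  case False
  with ab have less: "a' < b'" by simp
  let ?I = "{a'..b'}"
  define x m1 m2 where "x s = fst (d s)" and "m1 s = fst (snd (d s))" and "m2 s = snd (snd (d s))" for s
  define u1 u2 where "u1 s = x s - m1 s" and "u2 s = x s - m2 s" for s
  have d: "d s = (x s, m1 s, m2 s)" for s by (simp add: x_def m1_def m2_def)
  have unit: "norm (u1 s) = 1" "norm (u2 s) = 1" if "s \<in> ?I" for s
    using hor that by (auto simp: horizontal_on_def config_space_def dist_norm d u1_def u2_def Pi_iff)
  obtain L where L: "L-lipschitz_on ?I d" using hor unfolding horizontal_on_def by blast
  have L0: "L \<ge> 0" using L lipschitz_on_nonneg by blast
  have lip: "L-lipschitz_on ?I x" "L-lipschitz_on ?I m1" "L-lipschitz_on ?I m2"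
  proof -
    have "dist (x s) (x t) \<le> dist (d s) (d t)" "dist (m1 s) (m1 t) \<le> dist (d s) (d t)"
      "dist (m2 s) (m2 t) \<le> dist (d s) (d t)" for s t
      unfolding x_def m1_def m2_def
      by (meson dist_fst_le dist_snd_le order_trans)+
    then show "L-lipschitz_on ?I x" "L-lipschitz_on ?I m1" "L-lipschitz_on ?I m2"
      using order_trans[OF _ lipschitz_onD[OF L]] L0 by (metis lipschitz_onI)+
  qed
  obtain N where N: "negligible N" and N_der: "\<forall>s\<in>?I - N. \<exists>x m1 m2 x' m1' m2'.
      d s = (x, m1, m2) \<and> (d has_vector_derivative (x', m1', m2')) (at s within ?I) \<and>
      (\<exists>r1::real. m1' = r1 *\<^sub>R (x - m1)) \<and> (\<exists>r2::real. m2' = r2 *\<^sub>R (x - m2))"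
    using hor unfolding horizontal_on_def by blast
  have der: "\<exists>Q r1 r2. (d has_vector_derivative (Q, r1 *\<^sub>R u1 s, r2 *\<^sub>R u2 s)) (at s within ?I)"
    if "s \<in> ?I - N" for s
    using bspec[OF N_der that] by (auto simp: d u1_def u2_def)
  define Q where "Q s = vector_derivative x (at s within ?I)" for s
  have der': "(x has_vector_derivative Q s) (at s within ?I) \<and>
      (u1 has_vector_derivative (Q s \<bullet> (\<i> * u1 s)) *\<^sub>R (\<i> * u1 s)) (at s within ?I) \<and>
      (u2 has_vector_derivative (Q s \<bullet> (\<i> * u2 s)) *\<^sub>R (\<i> * u2 s)) (at s within ?I)" if s: "s \<in> ?I - N" for s
  proof -
    obtain q r1 r2 where D: "(d has_vector_derivative (q, r1 *\<^sub>R u1 s, r2 *\<^sub>R u2 s)) (at s within ?I)"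
      using der[OF s] by blast
    note F = bounded_linear.has_vector_derivative[OF bounded_linear_fst]
    note S = bounded_linear.has_vector_derivative[OF bounded_linear_snd]
    have x: "(x has_vector_derivative q) (at s within ?I)"
      using F[OF D] by (simp add: x_def[abs_def])
    have m: "(m1 has_vector_derivative r1 *\<^sub>R u1 s) (at s within ?I)"
      "(m2 has_vector_derivative r2 *\<^sub>R u2 s) (at s within ?I)"
      using F[OF S[OF D]] S[OF S[OF D]] by (simp_all add: m1_def[abs_def] m2_def[abs_def])
    have "Q s = q"
      unfolding Q_def using vector_derivative_within_closed_interval[OF less _ x] s by auto
    then show ?thesis
      using rolling_arm_derivative[OF less _ unit(1)[unfolded u1_def] x m(1)[unfolded u1_def]]
        rolling_arm_derivative[OF less _ unit(2)[unfolded u2_def] x m(2)[unfolded u2_def]] x s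
      by (simp add: u1_def[abs_def] u2_def[abs_def])
  qed
  have Q_len: "integral ?I (\<lambda>s. norm (Q s)) = l"
  proof -
    have "link_x \<circ> d = x" by (auto simp: link_x_def x_def)
    then show ?thesis by (simp add: l linkage_length_def Q_def)
  qed
  obtain \<sigma> N' where N': "negligible N'" and \<sigma>: "\<sigma> a' = 0" "\<sigma> b' = l" "L-lipschitz_on ?I \<sigma>" "mono_on ?I \<sigma>"
    and \<sigma>': "\<And>s. s \<in> {a'..<b'} - N' \<Longrightarrow> (\<sigma> has_vector_derivative norm (Q s)) (at s within {s..b'})"
    using arc_length_function[OF ab lip(1) N, of Q] der' Q_len by (smt (verit) integral_cong)
  define \<tau> where "\<tau> s = a + \<sigma> s" for s
  have \<tau>_range: "\<tau> ` ?I \<subseteq> {a..b}"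
  proof (intro image_subsetI)
    fix s assume s: "s \<in> ?I"
    then have "\<sigma> a' \<le> \<sigma> s" "\<sigma> s \<le> \<sigma> b'" using mono_onD[OF \<sigma>(4)] ab by auto
    then show "\<tau> s \<in> {a..b}" using \<sigma> lb by (simp add: \<tau>_def)
  qed
  have "M \<ge> 0" using M(1)[of a] lb by auto
  define h where "h s = calib C t0 (\<tau> s) (x s) (u1 s) (u2 s)" for s
  have "lipschitzable_on ?I h"
  proof -
    have \<tau>: "lipschitzable_on ?I \<tau>"
      unfolding \<tau>_def by (intro lipschitzable_on_add lipschitzable_on_const lipschitzable_onI[OF \<sigma>(3)])
    note comp = lipschitzable_on_compose[OF \<tau> \<tau>_range]
    have X: "lipschitzable_on ?I (\<lambda>s. X (\<tau> s))" "lipschitzable_on ?I (\<lambda>s. U1 (\<tau> s))"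
       "lipschitzable_on ?I (\<lambda>s. U2 (\<tau> s))" "lipschitzable_on ?I (\<lambda>s. \<eta>1 (\<tau> s))" "lipschitzable_on ?I (\<lambda>s. \<eta>2 (\<tau> s))"
      using X_lipschitz[OF J] U_lipschitz[OF J] \<eta>_lipschitz[OF J _ M(1) \<open>M \<ge> 0\<close>]
      by (auto intro!: comp intro: lipschitzable_onI)
    have xu: "lipschitzable_on ?I x" "lipschitzable_on ?I u1" "lipschitzable_on ?I u2"
      unfolding u1_def u2_def using lip by (auto intro!: lipschitzable_on_diff intro: lipschitzable_onI)
    note mult = bounded_bilinear.lipschitzable_on_prod[OF bounded_bilinear_mult compact_Icc]
    note inner = bounded_bilinear.lipschitzable_on_prod[OF bounded_bilinear_inner compact_Icc]
    show ?thesis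
      unfolding h_def calib_def dev_def power2_norm_eq_inner divide_inverse
      by (intro lipschitzable_on_add lipschitzable_on_diff mult inner lipschitzable_on_const \<tau> X xu)
  qed
  then obtain Lh where Lh: "Lh-lipschitz_on ?I h" by (auto simp: lipschitzable_on_def)
  have "h b' \<le> h a'"
  proof (rule lipschitz_right_derivative_nonpos_imp_le[OF ab Lh])
    show "negligible (N \<union> N')" using N N' by simp
    fix s assume s: "s \<in> {a'..<b'} - (N \<union> N')"
    let ?A = "{s..b'}"
    have sub: "?A \<subseteq> ?I" and sI: "s \<in> ?I" using s by auto
    have ts: "\<tau> s \<in> {a..b}" using \<tau>_range sI by blast
    have "(\<tau> has_vector_derivative norm (Q s)) (at s within ?A)"
      unfolding \<tau>_def using \<sigma>'[of s] s by (auto intro!: derivative_eq_intros)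
    moreover have "\<tau> ` ?A \<subseteq> J" using \<tau>_range sub J by blast
    ultimately have "(h has_vector_derivative norm (Q s) * calib_dt C t0 (\<tau> s) (x s) (u1 s) (u2 s)
        + Q s \<bullet> calib_grad C t0 (\<tau> s) (x s) (u1 s) (u2 s)) (at s within ?A)"
      unfolding h_def using der'[of s] s sub
      by (intro calib_has_vector_derivative) (auto intro: has_vector_derivative_within_subset)
    moreover have "norm (Q s) * calib_dt C t0 (\<tau> s) (x s) (u1 s) (u2 s)
        + Q s \<bullet> calib_grad C t0 (\<tau> s) (x s) (u1 s) (u2 s) \<le> 0"
    proof -
      have "Q s \<bullet> calib_grad C t0 (\<tau> s) (x s) (u1 s) (u2 s) \<le> norm (Q s) * norm (calib_grad C t0 (\<tau> s) (x s) (u1 s) (u2 s))"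
        by (rule norm_cauchy_schwarz)
      moreover have "norm (Q s) * (calib_dt C t0 (\<tau> s) (x s) (u1 s) (u2 s)
          + norm (calib_grad C t0 (\<tau> s) (x s) (u1 s) (u2 s))) \<le> 0"
        using calib_subsolution[of "\<tau> s" "u1 s" "u2 s" M C t0] ts J unit[OF sI] M C
        by (intro mult_nonneg_nonpos) auto
      ultimately show ?thesis by (simp add: distrib_left)
    qed
    ultimately show "\<exists>D\<le>0. (h has_vector_derivative D) (at s within ?A)" by blast
  qed
  moreover have "h a' = 0"
    using start calib_self[of a] J lb by (auto simp: h_def \<tau>_def \<sigma> d lift_def u1_def u2_def)
  moreover have "h b' = calib C t0 (a + l) x' v1 v2"
    using end' by (simp add: h_def \<tau>_def \<sigma> d u1_def u2_def)
  ultimately show ?thesis by simp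
qed

text \<open>
  A competitor of length \<open>l < b - a\<close> would reach \<open>lift b\<close> when its clock shows \<open>a + l < b\<close>, where
  \<open>S \<le> 0\<close>.  While \<open>t\<close> runs from \<open>a + l\<close> to \<open>b\<close> with the linkage fixed at \<open>lift b\<close>, the function
  decreases strictly, as \<open>\<nabla> S\<close> stays close to the unit vector \<open>P\<close> on a short interval; but it
  ends at \<open>0\<close>.
\<close>

lemma competitor_is_longer:
  assumes less: "a \<le> b" and J: "{a..b} \<subseteq> J"
    and M: "\<And>t. t \<in> {a..b} \<Longrightarrow> \<bar>\<eta>1 t\<bar> \<le> M \<and> \<bar>\<eta>2 t\<bar> \<le> M" "\<And>t. t \<in> {a..b} \<Longrightarrow> \<bar>C * (t - t0)\<bar> \<le> 1"
    and C: "C \<ge> 2 * (M + 1) + 3 * (M + 1)\<^sup>2" and short: "3 * (M + 1) * (b - a) < 1"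
    and ab: "a' \<le> b'" and hor: "horizontal_on {a'..b'} d" and ends: "d a' = lift a" "d b' = lift b"
  shows "b - a \<le> linkage_length a' b' d"
proof (rule ccontr)
  define l where "l = linkage_length a' b' d"
  assume "\<not> b - a \<le> linkage_length a' b' d"
  then have lb: "a + l < b" by (simp add: l_def)
  have "l \<ge> 0" unfolding l_def linkage_length_def
    by (metis Henstock_Kurzweil_Integration.integral_nonneg norm_ge_zero not_integrable_integral order_refl)
  have M0: "M \<ge> 0" using M(1)[of a] less by auto
  define g where "g t = calib C t0 t (X b) (U1 b) (U2 b)" for t
  have g': "(g has_vector_derivative calib_dt C t0 t (X b) (U1 b) (U2 b)) (at t within {a..b})"
    if "t \<in> {a..b}" for t
    using calib_has_vector_derivative[of "\<lambda>t. t" 1 t "{a..b}" "\<lambda>_. X b" 0 "\<lambda>_. U1 b" "\<lambda>_. U2 b" C t0] that J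
    by (simp add: g_def[abs_def] has_vector_derivative_id)
  have bJ: "b \<in> J" using J less by auto
  have neg: "calib_dt C t0 t (X b) (U1 b) (U2 b) < 0" if t: "t \<in> {a..b}" for t
  proof -
    let ?V = "calib_grad C t0 t (X b) (U1 b) (U2 b)"
    have tJ: "t \<in> J" using t J by auto
    have conv: "convex {a..b}" by simp
    have bt: "b \<in> {a..b}" using less by auto
    have "norm (X b - X t) \<le> b - a" "norm (U1 b - U1 t) \<le> b - a" "norm (U2 b - U2 t) \<le> b - a"
      using lipschitz_onD[OF X_lipschitz[OF J conv] bt t] lipschitz_onD[OF U_lipschitz(1)[OF J conv] bt t]
        lipschitz_onD[OF U_lipschitz(2)[OF J conv] bt t] t by (auto simp: dist_norm)
    then have "(M + 1) * (norm (X b - X t) + norm (U1 b - U1 t) + norm (U2 b - U2 t)) \<le> (M + 1) * (3 * (b - a))"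
      using M0 by (intro mult_left_mono) auto
    also have "\<dots> < 1" using short by (simp add: algebra_simps)
    finally have "norm (?V - P t) < 1"
      using M t by (intro le_less_trans[OF calib_grad_diff[OF tJ U_unit(1)[OF bJ] U_unit(2)[OF bJ]]]) auto
    moreover have "norm (P t) - norm (?V - P t) \<le> norm ?V"
      using norm_triangle_ineq2[of "P t" "P t - ?V"] by (simp add: norm_minus_commute)
    ultimately have "norm ?V > 0"
      using P_unit[OF tJ] by linarith
    moreover have "calib_dt C t0 t (X b) (U1 b) (U2 b) + norm ?V \<le> 0"
      using M t C by (intro calib_subsolution[OF tJ U_unit(1)[OF bJ] U_unit(2)[OF bJ]]) auto
    ultimately show ?thesis by linarith
  qed
  have "g (a + l) > g b"
  proof (rule DERIV_neg_imp_decreasing_open[OF lb])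
    show "continuous_on {a + l..b} g"
    proof (rule continuous_on_subset)
      show "continuous_on {a..b} g"
        using has_vector_derivative_continuous[OF g'] by (auto simp: continuous_on_eq_continuous_within)
    qed (use \<open>l \<ge> 0\<close> in auto)
    fix t assume t: "a + l < t" "t < b"
    then have "at t within {a..b} = at t" using \<open>l \<ge> 0\<close> by (intro at_within_interior) simp
    with g'[of t] neg[of t] t \<open>l \<ge> 0\<close> show "\<exists>y. DERIV g t :> y \<and> y < 0"
      by (auto simp: has_real_derivative_iff_has_vector_derivative)
  qed
  moreover have "g b = 0" by (simp add: g_def calib_self bJ)
  moreover have "g (a + l) \<le> 0"
    unfolding g_def
    by (rule calib_competitor[OF ab hor ends(1) l_def _ less J M C]) (use lb ends(2) in \<open>auto simp: lift_def\<close>)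
  ultimately show False by simp
qed

lemma geodesic_lift:
  assumes "interior J \<noteq> {}"
  shows "geodesic_on J lift"
proof -
  have "\<exists>\<epsilon>>0. \<forall>a b. a \<le> b \<and> {a..b} \<subseteq> J \<inter> ball t0 \<epsilon> \<longrightarrow>
        (\<forall>a' b' d. a' \<le> b' \<and> horizontal_on {a'..b'} d \<and> d a' = lift a \<and> d b' = lift b \<longrightarrow>
           linkage_length a b lift \<le> linkage_length a' b' d)" if t0: "t0 \<in> J" for t0
  proof -
    define M where "M = \<bar>\<eta>1 t0\<bar> + \<bar>\<eta>2 t0\<bar> + 1"
    define C where "C = 2 * (M + 1) + 3 * (M + 1)\<^sup>2"
    have M1: "M \<ge> 1" by (simp add: M_def)
    then have C0: "C > 0" by (simp add: C_def add_pos_nonneg)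
    have cont: "continuous (at t0 within J) \<eta>1" "continuous (at t0 within J) \<eta>2"
      using \<eta>1'[OF t0] \<eta>2'[OF t0] has_vector_derivative_continuous by auto
    obtain \<delta>1 where \<delta>1: "\<delta>1 > 0" "\<And>t. t \<in> J \<Longrightarrow> dist t t0 < \<delta>1 \<Longrightarrow> dist (\<eta>1 t) (\<eta>1 t0) < 1"
      using cont(1)[unfolded continuous_within_eps_delta, rule_format, OF zero_less_one] by blast
    obtain \<delta>2 where \<delta>2: "\<delta>2 > 0" "\<And>t. t \<in> J \<Longrightarrow> dist t t0 < \<delta>2 \<Longrightarrow> dist (\<eta>2 t) (\<eta>2 t0) < 1"
      using cont(2)[unfolded continuous_within_eps_delta, rule_format, OF zero_less_one] by blast
    \<comment> \<open>\<open>\<delta>1\<close>, \<open>\<delta>2\<close> keep the momenta below \<open>M\<close>, \<open>1 / C\<close> keeps \<open>C * (t - t0)\<close> below one, and the last bound makes \<open>3 * (M + 1) * (b - a) < 1\<close>.\<close>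
    define \<epsilon> where "\<epsilon> = Min {\<delta>1, \<delta>2, 1 / C, 1 / (6 * (M + 1))}"
    have "\<epsilon> > 0" using \<delta>1(1) \<delta>2(1) C0 M1 by (simp add: \<epsilon>_def)
    have \<epsilon>: "\<epsilon> \<le> \<delta>1" "\<epsilon> \<le> \<delta>2" "\<epsilon> \<le> 1 / C" "\<epsilon> \<le> 1 / (6 * (M + 1))" by (simp_all add: \<epsilon>_def)
    have "linkage_length a b lift \<le> linkage_length a' b' d"
      if ab: "a \<le> b" "{a..b} \<subseteq> J \<inter> ball t0 \<epsilon>" and d: "a' \<le> b'" "horizontal_on {a'..b'} d" "d a' = lift a" "d b' = lift b"
      for a b a' b' d
    proof -
      have near: "t \<in> J" "dist t t0 < \<epsilon>" if "t \<in> {a..b}" for t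
        using ab(2) that by (auto simp: dist_commute)
      have "b - a \<le> linkage_length a' b' d"
      proof (rule competitor_is_longer[OF ab(1) _ _ _ _ _ d])
        show "{a..b} \<subseteq> J" using ab(2) by blast
        show "2 * (M + 1) + 3 * (M + 1)\<^sup>2 \<le> C" by (simp add: C_def)
        fix t assume t: "t \<in> {a..b}"
        have "dist (\<eta>1 t) (\<eta>1 t0) < 1" "dist (\<eta>2 t) (\<eta>2 t0) < 1"
          using \<delta>1(2)[of t] \<delta>2(2)[of t] near[OF t] \<epsilon> by auto
        then show "\<bar>\<eta>1 t\<bar> \<le> M \<and> \<bar>\<eta>2 t\<bar> \<le> M" by (auto simp: M_def dist_real_def)
        have "C * \<bar>t - t0\<bar> \<le> C * (1 / C)"
          using near(2)[OF t] \<epsilon>(3) C0 by (intro mult_left_mono) (auto simp: dist_real_def)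
        then show "\<bar>C * (t - t0)\<bar> \<le> 1" using C0 by (simp add: abs_mult)
      next
        have "b - a < 2 * (1 / (6 * (M + 1)))"
          using near(2)[of a] near(2)[of b] ab(1) \<epsilon>(4) by (auto simp: dist_real_def)
        then show "3 * (M + 1) * (b - a) < 1" using M1 by (simp add: field_simps)
      qed
      then show ?thesis using linkage_length_lift[OF ab(1)] ab(2) by simp
    qed
    with \<open>\<epsilon> > 0\<close> show ?thesis by blast
  qed
  with interval assms horizontal_lift linkage_length_lift show ?thesis
    unfolding geodesic_on_def by simp
qed

end

section \<open>Lifting an elastica\<close>

text \<open>
  The interval may be open, closed, half-open or unbounded.  Near each of its points it agrees with a
  compact subinterval, on which the fundamental theorem of calculus applies.
\<close>

lemma interval_antiderivative:
  fixes f :: "real \<Rightarrow> real"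
  assumes I: "is_interval I" and cont: "continuous_on I f"
  shows "\<exists>F. \<forall>t\<in>I. (F has_real_derivative f t) (at t within I)"
proof (cases "I = {}")
  case False
  then obtain t0 where t0: "t0 \<in> I" by blast
  define F where "F t = integral {t0..t} f - integral {t..t0} f" for t
  have sub: "{a..b} \<subseteq> I" if "a \<in> I" "b \<in> I" for a b
    using I that unfolding is_interval_1 by (meson atLeastAtMost_iff subsetI)
  have "(F has_real_derivative f t) (at t within I)" if t: "t \<in> I" for t
  proof -
    have mI: "min t t0 \<in> I" "max t t0 \<in> I" using t t0 by (auto simp: min_def max_def)
    \<comment> \<open>\<open>a\<close> lies strictly to the left of \<open>t\<close> unless \<open>t\<close> is the left end of \<open>I\<close>; likewise \<open>b\<close> on the right.\<close>
    obtain a where a: "a \<in> I" "a \<le> min t t0" "a < t \<or> (\<forall>y\<in>I. t \<le> y)"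
    proof (cases "\<exists>y\<in>I. y < min t t0")
      case True
      then obtain y where "y \<in> I" "y < min t t0" by blast
      then show ?thesis by (intro that[of y]) auto
    next
      case False
      then show ?thesis by (intro that[OF mI(1)]) (auto simp: min_def not_less)
    qed
    obtain b where b: "b \<in> I" "max t t0 \<le> b" "t < b \<or> (\<forall>y\<in>I. y \<le> t)"
    proof (cases "\<exists>y\<in>I. max t t0 < y")
      case True
      then obtain y where "y \<in> I" "max t t0 < y" by blast
      then show ?thesis by (intro that[of y]) auto
    next
      case False
      then show ?thesis by (intro that[OF mI(2)]) (auto simp: max_def not_less)
    qed
    have ab: "a \<le> t" "t \<le> b" "a \<le> t0" "t0 \<le> b" using a(2) b(2) by auto
    have cab: "continuous_on {a..b} f" by (rule continuous_on_subset[OF cont sub[OF a(1) b(1)]])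
    then have int: "f integrable_on {a..b}" by (rule integrable_continuous_interval)
    have "((\<lambda>u. integral {a..u} f - integral {a..t0} f) has_vector_derivative f t - 0) (at t within {a..b})"
      by (intro has_vector_derivative_diff has_vector_derivative_const integral_has_vector_derivative cab) (use ab in auto)
    moreover have "F u = integral {a..u} f - integral {a..t0} f" if u: "u \<in> {a..b}" for u
    proof (cases "t0 \<le> u")
      case True
      then have "integral {u..t0} f = 0" by (cases "u = t0") auto
      moreover have "integral {a..t0} f + integral {t0..u} f = integral {a..u} f"
        using u ab True
        by (intro Henstock_Kurzweil_Integration.integral_combine integrable_on_subinterval[OF int]) auto
      ultimately show ?thesis by (simp add: F_def)
    next
      case False
      then have "integral {t0..u} f = 0" by auto
      moreover have "integral {a..u} f + integral {u..t0} f = integral {a..t0} f"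
        using u ab False
        by (intro Henstock_Kurzweil_Integration.integral_combine integrable_on_subinterval[OF int]) auto
      ultimately show ?thesis by (simp add: F_def)
    qed
    ultimately have "(F has_vector_derivative f t) (at t within {a..b})"
      using ab by (intro has_vector_derivative_transform[of t "{a..b}" F "\<lambda>u. integral {a..u} f - integral {a..t0} f"]) auto
    moreover have "at t within {a..b} = at t within I"
    proof (rule at_within_nhd)
      let ?S = "(if a < t then {a<..} else UNIV) \<inter> (if t < b then {..<b} else UNIV)"
      show "t \<in> ?S" "open ?S" by auto
      show "{a..b} \<inter> ?S - {t} = I \<inter> ?S - {t}"
        using sub[OF a(1) b(1)] a(3) b(3) ab by (auto intro: order_antisym)
    qed
    ultimately show ?thesis by (simp add: has_real_derivative_iff_has_vector_derivative)
  qed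
  then show ?thesis by blast
qed simp

text \<open>
  The equations for an arm direction \<open>U\<close> and its momentum \<open>\<eta>\<close> are nonlinear, but those for the pair
  \<open>(\<eta>, \<eta> U)\<close> are linear: \<open>\<eta>' = P \<bullet> (\<eta> U)\<close> and \<open>(\<eta> U)' = \<eta> P\<close>.  In the moving frame, \<open>\<eta> U = P (r + \<i> j)\<close>, they
  become the real system assumed here, and \<open>|U| = 1\<close> says that the solution is null.
\<close>

lemma null_solution_arm:
  fixes P :: "real \<Rightarrow> complex" and k \<eta> r j :: "real \<Rightarrow> real"
  assumes P: "(P has_vector_derivative k t *\<^sub>R (\<i> * P t)) (at t within J)" "norm (P t) = 1"
    and \<eta>: "(\<eta> has_real_derivative r t) (at t within J)"
    and r: "(r has_real_derivative \<eta> t + k t * j t) (at t within J)"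
    and j: "(j has_real_derivative - k t * r t) (at t within J)"
    and null: "(\<eta> t)\<^sup>2 = (r t)\<^sup>2 + (j t)\<^sup>2" "\<eta> t \<noteq> 0"
  defines "U \<equiv> \<lambda>t. (P t * Complex (r t) (j t)) /\<^sub>R \<eta> t"
  shows "norm (U t) = 1"
    and "(U has_vector_derivative (P t \<bullet> (\<i> * U t)) *\<^sub>R (\<i> * U t)) (at t within J)"
    and "(\<eta> has_vector_derivative \<eta> t * (P t \<bullet> U t)) (at t within J)"
    and "\<eta> t *\<^sub>R U t = P t * Complex (r t) (j t)"
proof -
  define z where "z t = complex_of_real (r t) + \<i> * complex_of_real (j t)" for t
  have z: "Complex (r t) (j t) = z t" for t by (simp add: z_def complex_eq_iff)
  have U: "U = (\<lambda>t. inverse (\<eta> t) *\<^sub>R (P t * z t))" by (simp add: U_def z)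
  have "norm (z t) = \<bar>\<eta> t\<bar>"
    using null(1) by (simp add: cmod_def z[symmetric] flip: null(1))
  then show nU: "norm (U t) = 1"
    using null(2) P(2) by (simp add: U norm_mult)
  show "\<eta> t *\<^sub>R U t = P t * Complex (r t) (j t)"
    using null(2) by (simp add: U z)
  have sqP: "(Re (P t))\<^sup>2 + (Im (P t))\<^sup>2 = 1" using P(2) by (simp add: cmod_def)
  have "P t \<bullet> U t = inverse (\<eta> t) * (((Re (P t))\<^sup>2 + (Im (P t))\<^sup>2) * r t)"
    by (simp add: U z_def inner_complex_def power2_eq_square algebra_simps)
  then have PU: "P t \<bullet> U t = r t / \<eta> t" using sqP by (simp add: divide_inverse_commute)
  then show "(\<eta> has_vector_derivative \<eta> t * (P t \<bullet> U t)) (at t within J)"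
    using \<eta> null(2) by (simp add: has_real_derivative_iff_has_vector_derivative)
  have "(z has_vector_derivative of_real (\<eta> t + k t * j t) + \<i> * of_real (- k t * r t)) (at t within J)"
    unfolding z_def using r j
    by (intro has_vector_derivative_add has_vector_derivative_mult_right has_vector_derivative_of_real)
      (simp_all add: has_real_derivative_iff_has_vector_derivative)
  from has_vector_derivative_mult[OF P(1) this]
  have Pz: "((\<lambda>t. P t * z t) has_vector_derivative \<eta> t *\<^sub>R P t) (at t within J)"
    by (rule has_vector_derivative_eq_rhs) (simp add: z_def scaleR_conv_of_real algebra_simps)
  have "((\<lambda>t. inverse (\<eta> t)) has_real_derivative - (r t / (\<eta> t)\<^sup>2)) (at t within J)"
    using \<eta> null(2) by (auto intro!: derivative_eq_intros simp: power2_eq_square divide_inverse)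
  from has_vector_derivative_scaleR[OF this Pz]
  have "(U has_vector_derivative inverse (\<eta> t) *\<^sub>R (\<eta> t *\<^sub>R P t) + - (r t / (\<eta> t)\<^sup>2) *\<^sub>R (P t * z t)) (at t within J)"
    by (simp add: U)
  moreover have "inverse (\<eta> t) *\<^sub>R (\<eta> t *\<^sub>R P t) + - (r t / (\<eta> t)\<^sup>2) *\<^sub>R (P t * z t) = P t - (P t \<bullet> U t) *\<^sub>R U t"
    unfolding PU using null(2) by (simp add: U power2_eq_square divide_inverse)
  ultimately have "(U has_vector_derivative P t - (P t \<bullet> U t) *\<^sub>R U t) (at t within J)"
    by simp
  moreover have "P t - (P t \<bullet> U t) *\<^sub>R U t = (P t \<bullet> (\<i> * U t)) *\<^sub>R (\<i> * U t)"
  proof -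
    have "(Re (U t))\<^sup>2 + (Im (U t))\<^sup>2 = 1" using nU by (simp add: cmod_def)
    then show ?thesis by (auto simp: complex_eq_iff inner_complex_def) algebra+
  qed
  ultimately show "(U has_vector_derivative (P t \<bullet> (\<i> * U t)) *\<^sub>R (\<i> * U t)) (at t within J)" by simp
qed

text \<open>
  The hypotheses say that \<open>L = (k, k1, b)\<close> is a solution of the linear system with \<open>\<langle>L, L\<rangle> = - g\<^sup>2\<close> for the form
  \<open>e\<^sup>2 - r\<^sup>2 - j\<^sup>2\<close>; the conclusion provides a solution orthogonal to \<open>L\<close> with square \<open>g\<^sup>2\<close>.  The plane
  orthogonal to \<open>L\<close> contains two null lines, spanned by \<open>(1, v)\<close> with
  \<open>v = (k \<plusminus> \<i> g) (k1 + \<i> b) / R\<^sup>2\<close> where \<open>R\<^sup>2 = k\<^sup>2 + g\<^sup>2 = k1\<^sup>2 + b\<^sup>2\<close>.  The flow fixes \<open>L\<close> and the form, so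
  it preserves each of these lines.  A vector on them is a solution for the right scalar factor, which is \<open>R exp (\<mp> \<theta>)\<close>
  with \<open>\<theta>' = g b / R\<^sup>2\<close>.  The solution given here is half the sum of these two.
\<close>

lemma spacelike_split:
  fixes k k1 b :: "real \<Rightarrow> real"
  assumes J: "is_interval J"
    and k: "\<And>t. t \<in> J \<Longrightarrow> (k has_real_derivative k1 t) (at t within J)"
    and k1: "\<And>t. t \<in> J \<Longrightarrow> (k1 has_real_derivative k t + k t * b t) (at t within J)"
    and b: "\<And>t. t \<in> J \<Longrightarrow> (b has_real_derivative - k t * k1 t) (at t within J)"
    and G: "\<And>t. t \<in> J \<Longrightarrow> (k1 t)\<^sup>2 + (b t)\<^sup>2 = (k t)\<^sup>2 + g\<^sup>2" and g: "g > 0"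
  obtains e r j where
    "\<And>t. t \<in> J \<Longrightarrow> (e has_real_derivative r t) (at t within J)"
    "\<And>t. t \<in> J \<Longrightarrow> (r has_real_derivative e t + k t * j t) (at t within J)"
    "\<And>t. t \<in> J \<Longrightarrow> (j has_real_derivative - k t * r t) (at t within J)"
    "\<And>t. t \<in> J \<Longrightarrow> (e t)\<^sup>2 = (r t)\<^sup>2 + (j t)\<^sup>2 + g\<^sup>2"
    "\<And>t. t \<in> J \<Longrightarrow> k t * e t = k1 t * r t + b t * j t"
    "\<And>t. t \<in> J \<Longrightarrow> \<bar>k t\<bar> < e t"
proof -
  define R where "R t = sqrt ((k t)\<^sup>2 + g\<^sup>2)" for t
  have R2: "(R t)\<^sup>2 = (k t)\<^sup>2 + g\<^sup>2" for t by (simp add: R_def)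
  have Rpos: "R t > 0" for t using g by (simp add: R_def add_nonneg_pos)
  have cont: "continuous_on J (\<lambda>t. g * b t / (R t)\<^sup>2)"
  proof -
    have "continuous_on J b" "continuous_on J k"
      using b k by (auto intro!: DERIV_continuous_on)
    then show ?thesis
      using g by (auto intro!: continuous_intros simp: R2 add_nonneg_eq_0_iff)
  qed
  obtain \<theta> where \<theta>: "\<And>t. t \<in> J \<Longrightarrow> (\<theta> has_real_derivative g * b t / (R t)\<^sup>2) (at t within J)"
    using interval_antiderivative[OF J cont] by blast
  have R': "(R has_real_derivative k t * k1 t / R t) (at t within J)" if "t \<in> J" for t
  proof -
    have "((\<lambda>t. (k t)\<^sup>2 + g\<^sup>2) has_real_derivative 2 * k t * k1 t) (at t within J)"
      by (rule DERIV_cong, (rule derivative_eq_intros k[OF that] refl)+) simp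
    moreover have "(k t)\<^sup>2 + g\<^sup>2 > 0" using g by (simp add: add_nonneg_pos)
    ultimately show ?thesis
      unfolding R_def[abs_def]
      by (intro DERIV_cong[OF DERIV_chain2[OF DERIV_real_sqrt]]) (auto simp: divide_simps)
  qed
  define e where "e t = R t * cosh (\<theta> t)" for t
  define r where "r t = (k1 t * k t * cosh (\<theta> t) + b t * g * sinh (\<theta> t)) / R t" for t
  define j where "j t = (b t * k t * cosh (\<theta> t) - k1 t * g * sinh (\<theta> t)) / R t" for t
  show ?thesis
  proof (rule that)
    fix t assume t: "t \<in> J"
    define c s where "c = cosh (\<theta> t)" and "s = sinh (\<theta> t)"
    have cs: "c\<^sup>2 = 1 + s\<^sup>2" unfolding c_def s_def by (simp add: cosh_square_eq)
    have Rne: "R t \<noteq> 0" using Rpos[of t] by simp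
    note Gt = G[OF t] and R2t = R2[of t]
    show "(e has_real_derivative r t) (at t within J)"
      unfolding e_def[abs_def]
      by (rule DERIV_cong, (rule derivative_eq_intros R'[OF t] \<theta>[OF t] refl)+)
        (use Rne in \<open>simp add: r_def field_simps power2_eq_square\<close>)
    \<comment> \<open>The derivative of \<open>\<theta>\<close>, kept opaque so that the identities below are polynomial.\<close>
    define d where "d = g * b t / (R t)\<^sup>2"
    have d: "d * (R t)\<^sup>2 = g * b t" using Rne by (simp add: d_def)
    note D = k[OF t] k1[OF t] b[OF t] \<theta>[OF t, folded d_def]
    let ?n = "k1 t * k t * c + b t * g * s" and ?m = "b t * k t * c - k1 t * g * s"
    let ?n' = "(k t + k t * b t) * k t * c + k1 t * k1 t * c + k1 t * k t * s * d - k t * k1 t * g * s + b t * g * c * d"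
    let ?m' = "- k t * k1 t * k t * c + b t * k1 t * c + b t * k t * s * d - (k t + k t * b t) * g * s - k1 t * g * c * d"
    have "((\<lambda>t. k1 t * k t * cosh (\<theta> t) + b t * g * sinh (\<theta> t)) has_real_derivative ?n') (at t within J)"
      unfolding c_def s_def
      by (rule DERIV_cong, (rule derivative_eq_intros D refl)+) (simp add: algebra_simps)
    from DERIV_divide[OF this R'[OF t] Rne]
    have "(r has_real_derivative (?n' * R t - ?n * (k t * k1 t / R t)) / (R t * R t)) (at t within J)"
      unfolding r_def[abs_def] by (simp add: c_def s_def)
    moreover have "(?n' * R t - ?n * (k t * k1 t / R t)) / (R t * R t) = e t + k t * j t"
    proof -
      have "?n' * (R t)\<^sup>2 - ?n * (k t * k1 t) = ((R t)\<^sup>2 * c + k t * ?m) * (R t)\<^sup>2"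
        using Gt R2t d by algebra
      moreover have "e t + k t * j t = ((R t)\<^sup>2 * c + k t * ?m) / R t"
        using Rne by (simp add: e_def j_def c_def s_def add_divide_distrib power2_eq_square)
      moreover have "(N * R t - M / R t) / (R t * R t) = (N * (R t)\<^sup>2 - M) / (R t)\<^sup>2 / R t" for N M :: real
        using Rne by (simp add: divide_simps power2_eq_square)
      ultimately show ?thesis using Rne by simp
    qed
    ultimately show "(r has_real_derivative e t + k t * j t) (at t within J)" by simp
    have "((\<lambda>t. b t * k t * cosh (\<theta> t) - k1 t * g * sinh (\<theta> t)) has_real_derivative ?m') (at t within J)"
      unfolding c_def s_def
      by (rule DERIV_cong, (rule derivative_eq_intros D refl)+) (simp add: algebra_simps)
    from DERIV_divide[OF this R'[OF t] Rne]
    have "(j has_real_derivative (?m' * R t - ?m * (k t * k1 t / R t)) / (R t * R t)) (at t within J)"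
      unfolding j_def[abs_def] by (simp add: c_def s_def)
    moreover have "(?m' * R t - ?m * (k t * k1 t / R t)) / (R t * R t) = - k t * r t"
    proof -
      have "?m' * (R t)\<^sup>2 - ?m * (k t * k1 t) = - k t * ?n * (R t)\<^sup>2"
        using Gt R2t d by algebra
      moreover have "- k t * r t = - k t * ?n / R t"
        by (simp add: r_def c_def s_def)
      moreover have "(N * R t - M / R t) / (R t * R t) = (N * (R t)\<^sup>2 - M) / (R t)\<^sup>2 / R t" for N M :: real
        using Rne by (simp add: divide_simps power2_eq_square)
      ultimately show ?thesis using Rne by simp
    qed
    ultimately show "(j has_real_derivative - k t * r t) (at t within J)" by simp
    have rj: "r t = ?n / R t" "j t = ?m / R t" by (simp_all add: r_def j_def c_def s_def)
    have "(r t)\<^sup>2 + (j t)\<^sup>2 = ((k1 t * k t * c + b t * g * s)\<^sup>2 + (b t * k t * c - k1 t * g * s)\<^sup>2) / (R t)\<^sup>2"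
      unfolding rj by (simp add: power_divide flip: add_divide_distrib)
    also have "(k1 t * k t * c + b t * g * s)\<^sup>2 + (b t * k t * c - k1 t * g * s)\<^sup>2
        = (R t)\<^sup>2 * ((k t)\<^sup>2 * c\<^sup>2 + g\<^sup>2 * s\<^sup>2)"
      using Gt R2t by algebra
    finally have "(r t)\<^sup>2 + (j t)\<^sup>2 = (k t)\<^sup>2 * c\<^sup>2 + g\<^sup>2 * s\<^sup>2"
      using Rne by simp
    moreover have "(e t)\<^sup>2 = ((k t)\<^sup>2 + g\<^sup>2) * c\<^sup>2"
      by (simp add: e_def c_def power_mult_distrib R2)
    ultimately show "(e t)\<^sup>2 = (r t)\<^sup>2 + (j t)\<^sup>2 + g\<^sup>2"
      using cs by algebra
    have "k1 t * r t + b t * j t = ((k1 t)\<^sup>2 + (b t)\<^sup>2) * (k t * c) / R t"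
    proof -
      have "k1 t * ?n + b t * ?m = ((k1 t)\<^sup>2 + (b t)\<^sup>2) * (k t * c)" by algebra
      then show ?thesis unfolding rj by (simp flip: add_divide_distrib)
    qed
    also have "\<dots> = (R t)\<^sup>2 * (k t * c) / R t" by (simp add: Gt R2t)
    finally show "k t * e t = k1 t * r t + b t * j t"
      using Rne by (simp add: e_def c_def power2_eq_square)
    have "\<bar>k t\<bar> < R t"
      using g real_less_rsqrt[of "\<bar>k t\<bar>" "(k t)\<^sup>2 + g\<^sup>2"] by (simp add: R_def)
    also have "R t * 1 \<le> e t"
      unfolding e_def using Rpos[of t] cosh_real_ge_1 by (intro mult_left_mono) auto
    finally show "\<bar>k t\<bar> < e t" by simp
  qed
qed

text \<open>
  The elastica equation says that \<open>(k, k1, b)\<close> solves the linear system of \<open>null_solution_arm\<close>, and its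
  first integral is the invariant square of this triple.  The bound on \<open>A\<close> makes the triple spacelike, whatever
  the initial values are.
\<close>

lemma elastica_normal_extremal:
  fixes X P :: "real \<Rightarrow> complex" and k k1 :: "real \<Rightarrow> real"
  assumes J: "is_interval J"
    and X: "\<And>t. t \<in> J \<Longrightarrow> (X has_vector_derivative P t) (at t within J)"
    and P: "\<And>t. t \<in> J \<Longrightarrow> norm (P t) = 1"
      "\<And>t. t \<in> J \<Longrightarrow> (P has_vector_derivative k t *\<^sub>R (\<i> * P t)) (at t within J)"
    and k: "\<And>t. t \<in> J \<Longrightarrow> (k has_real_derivative k1 t) (at t within J)"
    and k1: "\<And>t. t \<in> J \<Longrightarrow> (k1 has_real_derivative - (A * k t + k t ^ 3 / 2)) (at t within J)"
    and A: "\<bar>A\<bar> < 1 / 2"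
  shows "\<exists>p U1 U2 \<eta>1 \<eta>2. normal_extremal J p X P U1 U2 \<eta>1 \<eta>2"
proof (cases "J = {}")
  case True
  then show ?thesis using J by (auto simp: normal_extremal_def)
next
  case False
  have conv: "convex J" using J by (simp add: is_interval_convex_1)
  define b where "b t = - (1 + A + (k t)\<^sup>2 / 2)" for t
  have k1b: "(k1 has_real_derivative k t + k t * b t) (at t within J)" if "t \<in> J" for t
    by (rule DERIV_cong[OF k1[OF that]]) (simp add: b_def algebra_simps power2_eq_square power3_eq_cube)
  have b: "(b has_real_derivative - k t * k1 t) (at t within J)" if "t \<in> J" for t
    unfolding b_def[abs_def] by (rule DERIV_cong, (rule derivative_eq_intros k[OF that] refl numeral_neq_zero)+) simp
  define G where "G t = (k1 t)\<^sup>2 + (b t)\<^sup>2 - (k t)\<^sup>2" for t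
  have "(G has_field_derivative 0) (at t within J)" if "t \<in> J" for t
    unfolding G_def[abs_def]
    by (rule DERIV_cong, (rule derivative_eq_intros k[OF that] k1b[OF that] b[OF that] refl)+)
      (simp add: algebra_simps)
  with has_field_derivative_zero_constant[OF conv] obtain G0 where G0: "\<And>t. t \<in> J \<Longrightarrow> G t = G0"
    by blast
  have "G0 > 0"
  proof -
    obtain t where t: "t \<in> J" using False by blast
    have "G t = (k1 t)\<^sup>2 + (A + (k t)\<^sup>2 / 2)\<^sup>2 + (1 + 2 * A)"
      by (simp add: G_def b_def power2_eq_square algebra_simps)
    also have "1 + 2 * A > 0" using A by linarith
    then have "(k1 t)\<^sup>2 + (A + (k t)\<^sup>2 / 2)\<^sup>2 + (1 + 2 * A) > 0" by (rule add_nonneg_pos[rotated]) simp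
    finally show ?thesis using G0[OF t] by simp
  qed
  define g where "g = sqrt G0"
  have g: "g > 0" "g\<^sup>2 = G0" using \<open>G0 > 0\<close> by (simp_all add: g_def)
  have Geq: "(k1 t)\<^sup>2 + (b t)\<^sup>2 = (k t)\<^sup>2 + g\<^sup>2" if "t \<in> J" for t
    using G0[OF that] by (simp add: G_def g)
  obtain e r j where e: "\<And>t. t \<in> J \<Longrightarrow> (e has_real_derivative r t) (at t within J)"
    and r: "\<And>t. t \<in> J \<Longrightarrow> (r has_real_derivative e t + k t * j t) (at t within J)"
    and j: "\<And>t. t \<in> J \<Longrightarrow> (j has_real_derivative - k t * r t) (at t within J)"
    and sq: "\<And>t. t \<in> J \<Longrightarrow> (e t)\<^sup>2 = (r t)\<^sup>2 + (j t)\<^sup>2 + g\<^sup>2"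
    and orth: "\<And>t. t \<in> J \<Longrightarrow> k t * e t = k1 t * r t + b t * j t"
    and big: "\<And>t. t \<in> J \<Longrightarrow> \<bar>k t\<bar> < e t"
    using spacelike_split[OF J k k1b b Geq g(1)] by blast
  \<comment> \<open>For the two signs \<open>\<epsilon> = 1\<close> and \<open>\<epsilon> = -1\<close> these are the two null solutions with sum \<open>(k, k1, b)\<close>.\<close>
  define h r' j' where "h \<epsilon> t = (k t + \<epsilon> * e t) / 2" and "r' \<epsilon> t = (k1 t + \<epsilon> * r t) / 2"
    and "j' \<epsilon> t = (b t + \<epsilon> * j t) / 2" for \<epsilon> t :: real
  define U where "U \<epsilon> t = (P t * Complex (r' \<epsilon> t) (j' \<epsilon> t)) /\<^sub>R h \<epsilon> t" for \<epsilon> t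
  have arm: "norm (U \<epsilon> t) = 1"
    "(U \<epsilon> has_vector_derivative (P t \<bullet> (\<i> * U \<epsilon> t)) *\<^sub>R (\<i> * U \<epsilon> t)) (at t within J)"
    "(h \<epsilon> has_vector_derivative h \<epsilon> t * (P t \<bullet> U \<epsilon> t)) (at t within J)"
    "h \<epsilon> t *\<^sub>R U \<epsilon> t = P t * Complex (r' \<epsilon> t) (j' \<epsilon> t)"
    if t: "t \<in> J" and \<epsilon>: "\<epsilon> = 1 \<or> \<epsilon> = -1" for t \<epsilon>
  proof -
    have 1: "(h \<epsilon> has_real_derivative r' \<epsilon> t) (at t within J)"
      unfolding h_def[abs_def] r'_def
      by (rule DERIV_cong, (rule derivative_eq_intros k[OF t] e[OF t] refl numeral_neq_zero)+) simp
    have 2: "(r' \<epsilon> has_real_derivative h \<epsilon> t + k t * j' \<epsilon> t) (at t within J)"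
      unfolding r'_def[abs_def] h_def j'_def
      by (rule DERIV_cong, (rule derivative_eq_intros k1b[OF t] r[OF t] refl numeral_neq_zero)+) (simp add: field_simps)
    have 3: "(j' \<epsilon> has_real_derivative - k t * r' \<epsilon> t) (at t within J)"
      unfolding j'_def[abs_def] r'_def
      by (rule DERIV_cong, (rule derivative_eq_intros b[OF t] j[OF t] refl numeral_neq_zero)+) (simp add: field_simps)
    have \<epsilon>2: "\<epsilon> * \<epsilon> = 1" using \<epsilon> by auto
    have 4: "(h \<epsilon> t)\<^sup>2 = (r' \<epsilon> t)\<^sup>2 + (j' \<epsilon> t)\<^sup>2"
      unfolding h_def r'_def j'_def power_divide add_divide_distrib[symmetric]
      using sq[OF t] orth[OF t] Geq[OF t] \<epsilon>2 by algebra
    \<comment> \<open>By \<open>big\<close>, \<open>h 1 > 0\<close> and \<open>h (-1) < 0\<close>: the two momenta have opposite signs.\<close>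
    have 5: "h \<epsilon> t \<noteq> 0" using big[OF t] \<epsilon> by (auto simp: h_def)
    note N = null_solution_arm[of P k t J "h \<epsilon>" "r' \<epsilon>" "j' \<epsilon>", OF P(2)[OF t] P(1)[OF t] 1 2 3 4 5]
    show "norm (U \<epsilon> t) = 1"
      "(U \<epsilon> has_vector_derivative (P t \<bullet> (\<i> * U \<epsilon> t)) *\<^sub>R (\<i> * U \<epsilon> t)) (at t within J)"
      "(h \<epsilon> has_vector_derivative h \<epsilon> t * (P t \<bullet> U \<epsilon> t)) (at t within J)"
      "h \<epsilon> t *\<^sub>R U \<epsilon> t = P t * Complex (r' \<epsilon> t) (j' \<epsilon> t)"
      using N by (simp_all add: U_def[abs_def])
  qed
  \<comment> \<open>The constant force \<open>p\<close> of the elastica, written in the moving frame.\<close>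
  define q where "q t = P t - \<i> * (P t * (complex_of_real (k1 t) + \<i> * complex_of_real (b t)))" for t
  have sum: "h 1 t *\<^sub>R U 1 t + h (-1) t *\<^sub>R U (-1) t = P t * (complex_of_real (k1 t) + \<i> * complex_of_real (b t))"
    if "t \<in> J" for t
  proof -
    have "Complex (r' 1 t) (j' 1 t) + Complex (r' (-1) t) (j' (-1) t) = complex_of_real (k1 t) + \<i> * complex_of_real (b t)"
      by (simp add: complex_eq_iff r'_def j'_def field_simps)
    then show ?thesis using arm(4)[OF that] by (simp flip: distrib_left)
  qed
  have "(q has_vector_derivative 0) (at t within J)" if t: "t \<in> J" for t
    unfolding q_def[abs_def]
    by (rule has_vector_derivative_eq_rhs,
        (rule P(2)[OF t] k1b[OF t] b[OF t] has_vector_derivative_diff has_vector_derivative_add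
          has_vector_derivative_mult_right has_vector_derivative_mult has_vector_derivative_of_real)+)
      (simp add: scaleR_conv_of_real algebra_simps)
  then obtain p where p: "\<And>t. t \<in> J \<Longrightarrow> q t = p"
    using has_derivative_zero_constant[OF conv, of q] by (auto simp: has_vector_derivative_def)
  have "normal_extremal J p X P (U 1) (U (-1)) (h 1) (h (-1))"
  proof
    fix t assume t: "t \<in> J"
    show "P t = p + \<i> * (h 1 t *\<^sub>R U 1 t + h (-1) t *\<^sub>R U (-1) t)"
      unfolding sum[OF t] p[OF t, symmetric] q_def by simp
    \<comment> \<open>If the directions agreed, the sum of the two null vectors would be null.\<close>
    show "U 1 t \<noteq> U (-1) t"
    proof
      assume eq: "U 1 t = U (-1) t"
      have "h 1 t + h (-1) t = k t" by (simp add: h_def field_simps)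
      then have "k t *\<^sub>R U 1 t = P t * (complex_of_real (k1 t) + \<i> * complex_of_real (b t))"
        using sum[OF t] eq by (metis scaleR_left.add)
      then have "\<bar>k t\<bar> = norm (complex_of_real (k1 t) + \<i> * complex_of_real (b t))"
        using arm(1)[OF t, of 1] P(1)[OF t] by (metis mult_1 mult.right_neutral norm_mult norm_scaleR)
      then have "(k t)\<^sup>2 = (k1 t)\<^sup>2 + (b t)\<^sup>2"
        by (metis cmod_power2 complex_eq complex.sel(1) complex.sel(2) power2_abs)
      with Geq[OF t] g(1) show False by simp
    qed
  qed (use J X P arm in auto)
  then show ?thesis by blast
qed

section \<open>Every shape of elastica\<close>

theorem theorem5:
  fixes I :: "real set" and \<gamma> :: "real \<Rightarrow> complex"
  assumes "elastica_on I \<gamma>"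
  shows "\<exists>J c. geodesic_on J c \<and> similar_curves I \<gamma> J (link_x \<circ> c)"
proof -
  obtain \<kappa> \<kappa>' \<kappa>'' A where I: "is_interval I" "interior I \<noteq> {}"
    and unit: "unit_speed_with_curvature I \<gamma> \<kappa>"
    and \<kappa>: "\<And>s. s \<in> I \<Longrightarrow> (\<kappa> has_real_derivative \<kappa>' s) (at s within I)"
      "\<And>s. s \<in> I \<Longrightarrow> (\<kappa>' has_real_derivative \<kappa>'' s) (at s within I)"
      "\<And>s. s \<in> I \<Longrightarrow> \<kappa>'' s + 1/2 * \<kappa> s ^ 3 + A * \<kappa> s = 0"
    using assms unfolding elastica_on_def by blast
  obtain T where T: "\<And>s. s \<in> I \<Longrightarrow> (\<gamma> has_vector_derivative T s) (at s within I)"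
      "\<And>s. s \<in> I \<Longrightarrow> norm (T s) = 1"
      "\<And>s. s \<in> I \<Longrightarrow> (T has_vector_derivative \<kappa> s *\<^sub>R (\<i> * T s)) (at s within I)"
    using unit unfolding unit_speed_with_curvature_def by blast
  \<comment> \<open>Enlarging by \<open>l\<close> turns \<open>A\<close> into \<open>A / l\<^sup>2\<close>, which is below \<open>1/2\<close> in absolute value for this \<open>l\<close>.\<close>
  define l where "l = 1 + 2 * \<bar>A\<bar>"
  have l: "l > 0" "l \<noteq> 0" by (auto simp: l_def)
  have "2 * \<bar>A\<bar> < l\<^sup>2" unfolding l_def power2_eq_square by (simp add: algebra_simps add_pos_nonneg)
  define J where "J = (\<lambda>s. l * s) ` I"
  have J_back: "(\<lambda>t. t / l) ` J = I" using l by (force simp: J_def)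
  have J_mem: "t / l \<in> I" if "t \<in> J" for t using that l by (auto simp: J_def)
  have chain: "((\<lambda>t. f (t / l)) has_vector_derivative f' /\<^sub>R l) (at t within J)"
    if "(f has_vector_derivative f') (at (t / l) within I)" for f :: "real \<Rightarrow> 'b::real_normed_vector" and f' t
  proof -
    have "((\<lambda>t. t / l) has_vector_derivative inverse l) (at t within J)"
      using has_vector_derivative_divide[OF has_vector_derivative_id, of l] by (simp add: divide_inverse)
    from vector_diff_chain_within[OF this, of f f'] that show ?thesis
      unfolding J_back o_def by simp
  qed
  define X P where "X t = l *\<^sub>R \<gamma> (t / l)" and "P t = T (t / l)" for t
  define k k1 where "k t = \<kappa> (t / l) / l" and "k1 t = \<kappa>' (t / l) / l\<^sup>2" for t
  have convJ: "is_interval J"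
    using I(1) convex_scaling[of I l] by (simp add: J_def is_interval_convex_1)
  have "\<exists>p U1 U2 \<eta>1 \<eta>2. normal_extremal J p X P U1 U2 \<eta>1 \<eta>2"
  proof (rule elastica_normal_extremal[OF convJ, where k = k and ?k1.0 = k1 and A = "A / l\<^sup>2"])
    fix t assume "t \<in> J"
    then have t: "t / l \<in> I" by (rule J_mem)
    show "(X has_vector_derivative P t) (at t within J)"
      using bounded_linear.has_vector_derivative[OF bounded_linear_scaleR_right chain[OF T(1)[OF t]], of l] l
      by (simp add: X_def[abs_def] P_def)
    show "norm (P t) = 1" using T(2)[OF t] by (simp add: P_def)
    show "(P has_vector_derivative k t *\<^sub>R (\<i> * P t)) (at t within J)"
      using chain[OF T(3)[OF t]] by (simp add: P_def[abs_def] k_def divide_inverse mult.commute)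
    have "((\<lambda>t. \<kappa> (t / l)) has_real_derivative \<kappa>' (t / l) / l) (at t within J)"
      "((\<lambda>t. \<kappa>' (t / l)) has_real_derivative \<kappa>'' (t / l) / l) (at t within J)"
      using chain[of \<kappa> "\<kappa>' (t / l)" t] chain[of \<kappa>' "\<kappa>'' (t / l)" t] \<kappa>(1,2)[OF t]
      by (simp_all add: has_real_derivative_iff_has_vector_derivative divide_inverse mult.commute)
    from DERIV_cdivide[OF this(1), of l] DERIV_cdivide[OF this(2), of "l\<^sup>2"]
    show "(k has_real_derivative k1 t) (at t within J)"
      "(k1 has_real_derivative - (A / l\<^sup>2 * k t + k t ^ 3 / 2)) (at t within J)"
    proof -
      have "\<kappa>'' (t / l) = - (A * \<kappa> (t / l) + \<kappa> (t / l) ^ 3 / 2)" using \<kappa>(3)[OF t] by simp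
      then have "\<kappa>'' (t / l) / l / l\<^sup>2 = - (A / l\<^sup>2 * k t + k t ^ 3 / 2)"
        using l by (simp add: k_def field_simps power2_eq_square power3_eq_cube)
      with \<open>((\<lambda>t. \<kappa>' (t / l) / l\<^sup>2) has_real_derivative \<kappa>'' (t / l) / l / l\<^sup>2) (at t within J)\<close>
      show "(k1 has_real_derivative - (A / l\<^sup>2 * k t + k t ^ 3 / 2)) (at t within J)"
        by (simp add: k1_def[abs_def])
    qed (simp add: k_def[abs_def] k1_def power2_eq_square)
  next
    show "\<bar>A / l\<^sup>2\<bar> < 1 / 2"
      using \<open>2 * \<bar>A\<bar> < l\<^sup>2\<close> l by (simp add: abs_divide divide_less_eq)
  qed
  then obtain p U1 U2 \<eta>1 \<eta>2 where "normal_extremal J p X P U1 U2 \<eta>1 \<eta>2" by blast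
  then interpret normal_extremal J p X P U1 U2 \<eta>1 \<eta>2 .
  have "interior J = (\<lambda>s. l * s) ` interior I"
    unfolding J_def using l
    by (intro interior_injective_linear_image) (auto simp: inj_on_def linear_times)
  then have "geodesic_on J lift" using I(2) by (intro geodesic_lift) simp
  moreover have "similar_curves I \<gamma> J (link_x \<circ> lift)"
    unfolding similar_curves_def
  proof (intro exI conjI ballI)
    show "similarity (\<lambda>z. l *\<^sub>R z)"
      unfolding similarity_def using l by (intro exI[of _ l]) (simp add: dist_norm flip: scaleR_diff_right)
    show "homeomorphism I J (\<lambda>s. l * s) (\<lambda>t. t / l)"
      unfolding homeomorphism_def using l J_back by (auto simp: J_def intro!: continuous_intros)
    show "(link_x \<circ> lift) (l * s) = l *\<^sub>R \<gamma> s" if "s \<in> I" for s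
      using l by (simp add: link_x_def lift_def X_def)
  qed
  ultimately show ?thesis by blast
qed

end
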